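(* Let $P\in\mathbb P(V)$ and let $(P_n(\omega))_{n=0}^\infty$ be the corresponding polynomial sequence. Assume that $P_0=1$ and $P_n(0)=0$ for all $n\ge 1$. Assume that the corresponding lowering operators $Q(\theta)$ ($\theta\in V^*$) are shift-invariant. Let $T\in\mathcal L(\mathcal P(V^* ))$. Then $T$ is shift-invariant if and only if there exist $T_0\in\mathbb F$ and $T_k\in (V^{\odot k})^*$ for $k\in\mathbb N$ such that $$T=T_0\mathbf 1+\sum_{k=1}^\infty\langle T_k,Q^{k}\rangle .$$ In the latter case, $T_0=T1$ and $$\langle T_k,f_k\rangle=\frac1{k!}\big(T\langle P_k(\cdot),f_k\rangle\big)(0)\quad\text{for all }k\in\mathbb N,\ f_k\in V^{\odot k}.$$
   Context: $\mathbb F=\mathbb R$ or $\mathbb C$; $V$ is a vector space over $\mathbb F$ (of any dimension); $V^*$ is its algebraic dual; $\langle\cdot,\cdot\rangle$ denotes the dual pairing (also between $(V^{\odot n})^*$ and $V^{\odot n}$). $\mathbb N=\{1,2,\dots\}$, $\mathbb N_0=\mathbb N\cup\{0\}$. $\mathcal L(U,W)$ is the space of linear operators from $U$ to $W$, $\mathcal L(U)=\mathcal L(U,U)$. $V^{\odot n}$ is the $n$th algebraic symmetric tensor power of $V$, the linear span of the vectors $v_1\odot\dots\odot v_n=\frac1{n!}\sum_{\pi\in S_n}v_{\pi(1)}\otimes\dots\otimes v_{\pi(n)}$ (equivalently, of the vectors $v^{\otimes n}$, $v\in V$); $V^{\odot 0}=\mathbb F$, $v^{\otimes 0}=1$. For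 $\omega\in V^*$, $\omega^{\otimes n}\in(V^{\odot n})^*$ is given by $\langle\omega^{\otimes n},v_1\odot\dots\odot v_n\rangle=\prod_i\langle\omega,v_i\rangle$, and $\omega^{\otimes 0}=1$. Polynomials: $\mathcal P(V^* )$ is the vector space of functions $p:V^*\to\mathbb F$ of the form $p(\omega)=\sum_{k=0}^n\langle\omega^{\otimes k},f_k\rangle$ with $f_k\in V^{\odot k}$ (the $f_k$ are uniquely determined by $p$). For a vector space $W$, $\mathcal P(V^*,W)$ is the linear span of the functions $\omega\mapsto p(\omega)w$ with $p\in\mathcal P(V^* )$, $w\in W$. The shift operator $E(\theta)$, $\theta\in V^*$, is $(E(\theta)p)(\omega)=p(\omega+\theta)$; an operator $T\in\mathcal L(\mathcal P(V^* ))$ is shift-invariant if $TE(\theta)=E(\theta)T$ for all $\theta\in V^*$ (then $T1$ is a constant). The directional derivative is $(D(\theta)p)(\omega)=\frac{d}{dt}\big|_{t=0}p(\omega+t\theta)$. Polynomial sequences: $\mathbb P(V)$ is the set of operators $P\in\mathcal L(\mathcal P(V^* ))$ of the form $(P\langle\cdot^{\otimes n},f_n\rangle)(\omega)=\sum_{k=0}^n\langle\omega^{\otimes k},P_{kn}f_n\rangle$ for $f_n\in V^{\odot n}$, $n\in\mathbb N_0$, where $P_{kn}\in\mathcal L(V^{\odot n},V^{\odot k})$ and each $P_{nn}$ is bijective; such $P$ is a bijection of $\mathcal P(V^* )$. The corresponding polynomial sequence $(P_n(\omega))_{n=0}^\infty$, $P_n(\omega)\in(V^{\odot n})^*$, is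 defined by $\langle P_n(\omega),f_n\rangle=(P\langle\cdot^{\otimes n},f_n\rangle)(\omega)$. The lowering operators are $Q(\theta)=PD(\theta)P^{-1}$, $\theta\in V^*$. For $k\in\mathbb N$, $Q^k\in\mathcal L(\mathcal P(V^* ),\mathcal P(V^*,V^{\odot k}))$ is the operator satisfying $\langle\theta_1\odot\dots\odot\theta_k,(Q^kp)(\omega)\rangle=(Q(\theta_1)\dotsm Q(\theta_k)p)(\omega)$ for all $\theta_i\in V^*$, where $\langle\theta_1\odot\dots\odot\theta_k,v^{\otimes k}\rangle=\prod_i\langle\theta_i,v\rangle$; explicitly $(Q^k\langle P_n(\cdot),v^{\otimes n}\rangle)(\omega)=n(n-1)\dotsm(n-k+1)\,\langle P_{n-k}(\omega),v^{\otimes(n-k)}\rangle\,v^{\otimes k}$ (zero if $k>n$). For $T_k\in(V^{\odot k})^*$, $\langle T_k,Q^k\rangle\in\mathcal L(\mathcal P(V^* ))$ is $(\langle T_k,Q^k\rangle p)(\omega)=\langle T_k,(Q^kp)(\omega)\rangle$. The infinite sum of operators has only finitely many nonzero terms when applied to a fixed polynomial. $\mathbf 1$ is the identity operator. *)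

theory Defs
  imports
    "HOL-Analysis.Analysis"
    "HOL-Combinatorics.Permutations"
    "HOL-Library.Function_Algebras"
begin

text \<open>
  The scalar field is a type \<open>'f\<close> of class \<open>real_normed_field\<close>; by the Gelfand-Mazur theorem,
  \<open>\<real>\<close> and \<open>\<complex>\<close> are, up to isomorphism, the only such fields.  The vector space \<open>V\<close> is an
  arbitrary type \<open>'v\<close> with a scalar multiplication \<open>s\<close> satisfying \<open>vector_space s\<close>.
  Spaces whose elements are functions carry the pointwise operations.
\<close>

definition fscale :: "'f::times \<Rightarrow> ('x \<Rightarrow> 'f) \<Rightarrow> 'x \<Rightarrow> 'f"
  where "fscale c f = (\<lambda>x. c * f x)"

definition linear_on ::
    "('f \<Rightarrow> 'a::ab_group_add \<Rightarrow> 'a) \<Rightarrow> ('f \<Rightarrow> 'b::ab_group_add \<Rightarrow> 'b)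
      \<Rightarrow> 'a set \<Rightarrow> 'b set \<Rightarrow> ('a \<Rightarrow> 'b) \<Rightarrow> bool"
  where "linear_on s1 s2 U W L \<longleftrightarrow>
    (\<forall>x\<in>U. L x \<in> W) \<and>
    (\<forall>x\<in>U. \<forall>y\<in>U. L (x + y) = L x + L y) \<and>
    (\<forall>c. \<forall>x\<in>U. L (s1 c x) = s2 c (L x))"

definition dual :: "('f::field \<Rightarrow> 'v::ab_group_add \<Rightarrow> 'v) \<Rightarrow> ('v \<Rightarrow> 'f) set"
  where "dual s = {\<omega>. Vector_Spaces.linear s (*) \<omega>}"


section \<open>Symmetric tensor powers\<close>

definition multilinear ::
    "('f::field \<Rightarrow> 'v::ab_group_add \<Rightarrow> 'v) \<Rightarrow> ('f \<Rightarrow> 'w::ab_group_add \<Rightarrow> 'w)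
      \<Rightarrow> nat \<Rightarrow> ('v list \<Rightarrow> 'w) \<Rightarrow> bool"
  where "multilinear s sW n m \<longleftrightarrow>
    (\<forall>xs ys. length xs + length ys + 1 = n \<longrightarrow>
      Vector_Spaces.linear s sW (\<lambda>v. m (xs @ v # ys)))"

type_synonym ('v, 'f) tensor = "('v list \<Rightarrow> 'f) \<Rightarrow> 'f"

text \<open>
  The algebraic tensor power \<open>V\<^sup>\<otimes>\<^sup>n\<close> is realised as a subspace of the algebraic dual of the space of
  \<open>n\<close>-linear forms on \<open>V\<close>: \<open>v\<^sub>1 \<otimes> \<dots> \<otimes> v\<^sub>n\<close> is evaluation of \<open>n\<close>-linear forms at \<open>(v\<^sub>1, \<dots>, v\<^sub>n)\<close>.
  The universal property is lemma \<open>tensor_power_universal\<close> below.  All degrees share one type.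
\<close>

definition tensor ::
    "('f::field \<Rightarrow> 'v::ab_group_add \<Rightarrow> 'v) \<Rightarrow> 'v list \<Rightarrow> ('v, 'f) tensor"
  where "tensor s vs = (\<lambda>m. if multilinear s (*) (length vs) m then m vs else 0)"

definition tensor_power ::
    "('f::field \<Rightarrow> 'v::ab_group_add \<Rightarrow> 'v) \<Rightarrow> nat \<Rightarrow> ('v, 'f) tensor set"
  where "tensor_power s n = module.span fscale {tensor s vs |vs. length vs = n}"

definition sym_tensor ::
    "('f::field_char_0 \<Rightarrow> 'v::ab_group_add \<Rightarrow> 'v) \<Rightarrow> 'v list \<Rightarrow> ('v, 'f) tensor"
  where "sym_tensor s vs =
    fscale (1 / fact (length vs))
      (\<Sum>\<pi> | \<pi> permutes {..<length vs}. tensor s (permute_list \<pi> vs))"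

text \<open>
  For \<open>n = 0\<close> this is the line spanned by the empty tensor \<open>tensor s []\<close>, which plays the role of
  \<open>1\<close> in the identification of \<open>V\<^sup>\<odot>\<^sup>0\<close> with the scalar field.
\<close>

definition sym_power ::
    "('f::field_char_0 \<Rightarrow> 'v::ab_group_add \<Rightarrow> 'v) \<Rightarrow> nat \<Rightarrow> ('v, 'f) tensor set"
  where "sym_power s n = module.span fscale {sym_tensor s vs |vs. length vs = n}"

definition sym_dual ::
    "('f::field_char_0 \<Rightarrow> 'v::ab_group_add \<Rightarrow> 'v) \<Rightarrow> nat \<Rightarrow> (('v, 'f) tensor \<Rightarrow> 'f) set"
  where "sym_dual s n = {\<phi>. linear_on fscale (*) (sym_power s n) UNIV \<phi>}"

text \<open>
  \<open>dual_pair [\<theta>\<^sub>1, \<dots>, \<theta>\<^sub>k]\<close> is the functional on \<open>V\<^sup>\<otimes>\<^sup>k\<close> with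
  \<open>v\<^sub>1 \<otimes> \<dots> \<otimes> v\<^sub>k \<mapsto> \<langle>\<theta>\<^sub>1, v\<^sub>1\<rangle> \<cdots> \<langle>\<theta>\<^sub>k, v\<^sub>k\<rangle>\<close>.  On \<open>V\<^sup>\<odot>\<^sup>k\<close>, the only place where it is used, it is the
  pairing with \<open>\<theta>\<^sub>1 \<odot> \<dots> \<odot> \<theta>\<^sub>k\<close>; see \<open>dual_pair_replicate\<close> and \<open>dual_power_sym_tensor\<close> below.
\<close>

definition dual_pair :: "('v \<Rightarrow> 'f::comm_ring_1) list \<Rightarrow> ('v, 'f) tensor \<Rightarrow> 'f"
  where "dual_pair \<theta>s f = f (\<lambda>vs. prod_list (map2 (\<lambda>\<theta> v. \<theta> v) \<theta>s vs))"

definition dual_power :: "nat \<Rightarrow> ('v \<Rightarrow> 'f::comm_ring_1) \<Rightarrow> ('v, 'f) tensor \<Rightarrow> 'f"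
  where "dual_power n \<omega> = dual_pair (replicate n \<omega>)"


section \<open>Polynomials on the dual space\<close>

text \<open>
  Functions on \<open>V\<^sup>*\<close> are represented by functions on the ambient type \<open>'v \<Rightarrow> 'f\<close> vanishing
  outside \<open>dual s\<close>, so that equality of polynomials is equality of HOL functions.
  \<open>mono_poly s n f\<close> is the monomial \<open>\<omega> \<mapsto> \<langle>\<omega>\<^sup>\<otimes>\<^sup>n, f\<rangle>\<close>.
\<close>

definition mono_poly ::
    "('f::field \<Rightarrow> 'v::ab_group_add \<Rightarrow> 'v) \<Rightarrow> nat \<Rightarrow> ('v, 'f) tensor \<Rightarrow> ('v \<Rightarrow> 'f) \<Rightarrow> 'f"
  where "mono_poly s n f = (\<lambda>\<omega>. if \<omega> \<in> dual s then dual_power n \<omega> f else 0)"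

definition const_poly ::
    "('f::field \<Rightarrow> 'v::ab_group_add \<Rightarrow> 'v) \<Rightarrow> 'f \<Rightarrow> ('v \<Rightarrow> 'f) \<Rightarrow> 'f"
  where "const_poly s c = (\<lambda>\<omega>. if \<omega> \<in> dual s then c else 0)"

definition polys ::
    "('f::field_char_0 \<Rightarrow> 'v::ab_group_add \<Rightarrow> 'v) \<Rightarrow> (('v \<Rightarrow> 'f) \<Rightarrow> 'f) set"
  where "polys s = {p. \<exists>n f. (\<forall>k\<le>n. f k \<in> sym_power s k) \<and> p = (\<Sum>k\<le>n. mono_poly s k (f k))}"

definition vscale ::
    "('f \<Rightarrow> 'w \<Rightarrow> 'w) \<Rightarrow> 'f \<Rightarrow> ('x \<Rightarrow> 'w) \<Rightarrow> 'x \<Rightarrow> 'w"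
  where "vscale sW c g = (\<lambda>x. sW c (g x))"

definition polys_into ::
    "('f::field_char_0 \<Rightarrow> 'v::ab_group_add \<Rightarrow> 'v) \<Rightarrow> ('f \<Rightarrow> 'w::ab_group_add \<Rightarrow> 'w)
      \<Rightarrow> 'w set \<Rightarrow> (('v \<Rightarrow> 'f) \<Rightarrow> 'w) set"
  where "polys_into s sW W =
    module.span (vscale sW) {(\<lambda>\<omega>. sW (p \<omega>) w) |p w. p \<in> polys s \<and> w \<in> W}"

type_synonym ('v, 'f) poly_op = "(('v \<Rightarrow> 'f) \<Rightarrow> 'f) \<Rightarrow> (('v \<Rightarrow> 'f) \<Rightarrow> 'f)"

text \<open>Operators on \<open>\<P>(V\<^sup>*)\<close> matter only through their values on \<open>polys s\<close>.\<close>

definition poly_operators ::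
    "('f::field_char_0 \<Rightarrow> 'v::ab_group_add \<Rightarrow> 'v) \<Rightarrow> ('v, 'f) poly_op set"
  where "poly_operators s = {T. linear_on fscale fscale (polys s) (polys s) T}"

definition shift :: "('v \<Rightarrow> 'f::plus) \<Rightarrow> ('v, 'f) poly_op"
  where "shift \<theta> p = (\<lambda>\<omega>. p (\<omega> + \<theta>))"

definition shift_invariant ::
    "('f::field_char_0 \<Rightarrow> 'v::ab_group_add \<Rightarrow> 'v) \<Rightarrow> ('v, 'f) poly_op \<Rightarrow> bool"
  where "shift_invariant s T \<longleftrightarrow>
    (\<forall>\<theta>\<in>dual s. \<forall>p\<in>polys s. T (shift \<theta> p) = shift \<theta> (T p))"

definition dir_deriv :: "('v \<Rightarrow> 'f::real_normed_field) \<Rightarrow> ('v, 'f) poly_op"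
  where "dir_deriv \<theta> p = (\<lambda>\<omega>. deriv (\<lambda>t. p (\<omega> + fscale t \<theta>)) 0)"


section \<open>Polynomial sequences and lowering operators\<close>

text \<open>The set \<open>\<bbbP>(V)\<close>.\<close>

definition seq_operators ::
    "('f::field_char_0 \<Rightarrow> 'v::ab_group_add \<Rightarrow> 'v) \<Rightarrow> ('v, 'f) poly_op set"
  where "seq_operators s = {P. P \<in> poly_operators s \<and>
    (\<exists>C. (\<forall>n. \<forall>k\<le>n. linear_on fscale fscale (sym_power s n) (sym_power s k) (C k n)) \<and>
         (\<forall>n. bij_betw (C n n) (sym_power s n) (sym_power s n)) \<and>
         (\<forall>n. \<forall>f\<in>sym_power s n.
            P (mono_poly s n f) = (\<Sum>k\<le>n. mono_poly s k (C k n f))))}"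

definition poly_seq ::
    "('f::field \<Rightarrow> 'v::ab_group_add \<Rightarrow> 'v) \<Rightarrow> ('v, 'f) poly_op
      \<Rightarrow> nat \<Rightarrow> ('v \<Rightarrow> 'f) \<Rightarrow> ('v, 'f) tensor \<Rightarrow> 'f"
  where "poly_seq s P n \<omega> f = P (mono_poly s n f) \<omega>"

definition lowering ::
    "('f::real_normed_field \<Rightarrow> 'v::ab_group_add \<Rightarrow> 'v) \<Rightarrow> ('v, 'f) poly_op
      \<Rightarrow> ('v \<Rightarrow> 'f) \<Rightarrow> ('v, 'f) poly_op"
  where "lowering s P \<theta> p = P (dir_deriv \<theta> (inv_into (polys s) P p))"

text \<open>
  The operator \<open>Q\<^sup>k\<close>.  The described function exists for every \<open>P\<close> in \<open>\<bbbP>(V)\<close> and every polynomial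
  \<open>p\<close>: if \<open>p \<omega> = \<langle>P\<^sub>n(\<omega>), v\<^sup>\<otimes>\<^sup>n\<rangle>\<close>, it is
  \<open>\<omega> \<mapsto> n (n - 1) \<cdots> (n - k + 1) \<langle>P\<^bsub>n-k\<^esub>(\<omega>), v\<^sup>\<otimes>\<^sup>(\<^sup>n\<^sup>-\<^sup>k\<^sup>)\<rangle> v\<^sup>\<otimes>\<^sup>k\<close>, and these \<open>p\<close> span all polynomials.
  It is unique because the functionals \<open>\<theta>\<^sub>1 \<odot> \<dots> \<odot> \<theta>\<^sub>k\<close> separate the points of \<open>V\<^sup>\<odot>\<^sup>k\<close> and elements
  of \<open>polys_into\<close> vanish outside \<open>dual s\<close>.
\<close>

definition lowering_power ::
    "('f::real_normed_field \<Rightarrow> 'v::ab_group_add \<Rightarrow> 'v) \<Rightarrow> ('v, 'f) poly_op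
      \<Rightarrow> nat \<Rightarrow> (('v \<Rightarrow> 'f) \<Rightarrow> 'f) \<Rightarrow> ('v \<Rightarrow> 'f) \<Rightarrow> ('v, 'f) tensor"
  where "lowering_power s P k p =
    (THE g. g \<in> polys_into s fscale (sym_power s k) \<and>
      (\<forall>\<theta>s. set \<theta>s \<subseteq> dual s \<and> length \<theta>s = k \<longrightarrow>
        (\<forall>\<omega>\<in>dual s. dual_pair \<theta>s (g \<omega>) = foldr (lowering s P) \<theta>s p \<omega>)))"

definition pair_lowering_power ::
    "('f::real_normed_field \<Rightarrow> 'v::ab_group_add \<Rightarrow> 'v) \<Rightarrow> ('v, 'f) poly_op
      \<Rightarrow> nat \<Rightarrow> (('v, 'f) tensor \<Rightarrow> 'f) \<Rightarrow> ('v, 'f) poly_op"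
  where "pair_lowering_power s P k \<phi> p = (\<lambda>\<omega>. \<phi> (lowering_power s P k p \<omega>))"

text \<open>\<open>T = T\<^sub>0 \<one> + (\<Sum>k\<ge>1. \<langle>T\<^sub>k, Q\<^sup>k\<rangle>)\<close>, the sum being finite on every polynomial; \<open>Tk 0\<close> is not used.\<close>

definition lowering_expansion ::
    "('f::real_normed_field \<Rightarrow> 'v::ab_group_add \<Rightarrow> 'v) \<Rightarrow> ('v, 'f) poly_op
      \<Rightarrow> ('v, 'f) poly_op \<Rightarrow> 'f \<Rightarrow> (nat \<Rightarrow> ('v, 'f) tensor \<Rightarrow> 'f) \<Rightarrow> bool"
  where "lowering_expansion s P T T0 Tk \<longleftrightarrow>
    (\<forall>p\<in>polys s.
      finite {k. k \<ge> 1 \<and> pair_lowering_power s P k (Tk k) p \<noteq> 0} \<and>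
      T p = fscale T0 p +
        (\<Sum>k | k \<ge> 1 \<and> pair_lowering_power s P k (Tk k) p \<noteq> 0. pair_lowering_power s P k (Tk k) p))"


section \<open>Basic properties of the tensor model\<close>

lemma vector_space_fscale: "vector_space (fscale :: 'f::field \<Rightarrow> ('x \<Rightarrow> 'f) \<Rightarrow> 'x \<Rightarrow> 'f)"
  by unfold_locales (auto simp: fscale_def fun_eq_iff algebra_simps)

lemma multilinear_tensor:
  fixes s :: "'f::field \<Rightarrow> 'v::ab_group_add \<Rightarrow> 'v"
  assumes "vector_space s"
  shows "multilinear s fscale n (tensor s)"
  unfolding multilinear_def
proof (intro allI impI)
  fix xs ys :: "'v list" assume n: "length xs + length ys + 1 = n"
  have l: "Vector_Spaces.linear s (*) (\<lambda>v. m (xs @ v # ys))" if "multilinear s (*) n m" for m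
    using that n unfolding multilinear_def by blast
  show "Vector_Spaces.linear s fscale (\<lambda>v. tensor s (xs @ v # ys))"
    unfolding Vector_Spaces.linear_iff
  proof (intro conjI allI assms vector_space_fscale ext)
    fix x y :: 'v and m :: "'v list \<Rightarrow> 'f"
    show "tensor s (xs @ (x + y) # ys) m = (tensor s (xs @ x # ys) + tensor s (xs @ y # ys)) m"
      using l[of m] n by (auto simp: tensor_def Vector_Spaces.linear_iff)
  next
    fix x :: 'v and c :: 'f and m :: "'v list \<Rightarrow> 'f"
    show "tensor s (xs @ s c x # ys) m = fscale c (tensor s (xs @ x # ys)) m"
      using l[of m] n by (auto simp: tensor_def fscale_def Vector_Spaces.linear_iff)
  qed
qed

lemma tensor_power_universal:
  fixes s :: "'f::field \<Rightarrow> 'v::ab_group_add \<Rightarrow> 'v"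
    and sW :: "'f \<Rightarrow> 'w::ab_group_add \<Rightarrow> 'w"
  assumes "vector_space s" "vector_space sW" and \<phi>: "multilinear s sW n \<phi>"
  shows "\<exists>L. linear_on fscale sW (tensor_power s n) UNIV L \<and>
             (\<forall>vs. length vs = n \<longrightarrow> L (tensor s vs) = \<phi> vs)"
proof -
  interpret W: vector_space sW by fact
  interpret TT: vector_space "fscale :: 'f \<Rightarrow> ('v, 'f) tensor \<Rightarrow> ('v, 'f) tensor"
    by (rule vector_space_fscale)
  interpret F: vector_space "(*) :: 'f \<Rightarrow> 'f \<Rightarrow> 'f"
    by unfold_locales (auto simp: algebra_simps)
  interpret TW: vector_space_pair "fscale :: 'f \<Rightarrow> ('v, 'f) tensor \<Rightarrow> ('v, 'f) tensor" sW ..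
  interpret WF: vector_space_pair sW "(*) :: 'f \<Rightarrow> 'f \<Rightarrow> 'f" ..
  let ?S = "{tensor s vs |vs. length vs = n}"
  obtain B where B: "B \<subseteq> ?S" "TT.independent B" "?S \<subseteq> TT.span B"
    using TT.maximal_independent_subset[of ?S] by blast
  have "\<forall>b\<in>B. \<exists>vs. length vs = n \<and> b = tensor s vs" using B(1) by blast
  then obtain V where V: "\<And>b. b \<in> B \<Longrightarrow> length (V b) = n \<and> b = tensor s (V b)" by metis
  obtain L where L: "Vector_Spaces.linear fscale sW L" "\<forall>b\<in>B. L b = \<phi> (V b)"
    using TW.linear_independent_extend[OF B(2), of "\<lambda>b. \<phi> (V b)"] by blast
  have eval: "l (L x) = x (\<lambda>vs. l (\<phi> vs))"
    if l: "Vector_Spaces.linear sW (*) l" and x: "x \<in> TT.span B" for l x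
  proof -
    let ?m = "\<lambda>vs. l (\<phi> vs)"
    have m: "multilinear s (*) n ?m"
      using \<phi> l unfolding multilinear_def Vector_Spaces.linear_iff by simp
    show ?thesis
      using x
    proof (induction rule: TT.span_induct_alt)
      case base
      show ?case using L(1) l
        by (metis TW.linear_0 WF.linear_0 zero_fun_apply)
    next
      case (step c b y)
      have "b ?m = ?m (V b)" using V[OF step.hyps(1)] m by (metis tensor_def)
      moreover have "l (L (fscale c b + y)) = c * l (L b) + l (L y)"
        using L(1) l unfolding Vector_Spaces.linear_iff by metis
      moreover have "(fscale c b + y) ?m = c * b ?m + y ?m" by (simp add: fscale_def)
      ultimately show ?case using step L(2) by metis
    qed
  qed
  have "L (tensor s vs) = \<phi> vs" if n: "length vs = n" for vs
  proof (rule ccontr)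
    assume "L (tensor s vs) \<noteq> \<phi> vs"
    then have "W.independent {L (tensor s vs) - \<phi> vs}" by simp
    then obtain l where l: "Vector_Spaces.linear sW (*) l" "l (L (tensor s vs) - \<phi> vs) = 1"
      using WF.linear_independent_extend[of "{L (tensor s vs) - \<phi> vs}" "\<lambda>_. 1"] by blast
    have "tensor s vs \<in> TT.span B" using B(3) n by blast
    from eval[OF l(1) this] have "l (L (tensor s vs)) = tensor s vs (\<lambda>vs. l (\<phi> vs))" .
    also have "\<dots> = l (\<phi> vs)"
      using \<phi> l(1) n by (auto simp: tensor_def multilinear_def Vector_Spaces.linear_iff)
    finally show False using l WF.linear_diff[OF l(1)] by simp
  qed
  moreover have "linear_on fscale sW (tensor_power s n) UNIV L"
    using L(1) by (simp add: linear_on_def Vector_Spaces.linear_iff)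
  ultimately show ?thesis by blast
qed

lemma multilinear_prod:
  fixes s :: "'f::field \<Rightarrow> 'v::ab_group_add \<Rightarrow> 'v"
  assumes "vector_space s" and \<theta>s: "set \<theta>s \<subseteq> dual s"
  shows "multilinear s (*) (length \<theta>s) (\<lambda>vs. prod_list (map2 (\<lambda>\<theta> v. \<theta> v) \<theta>s vs))"
  unfolding multilinear_def
proof (intro allI impI)
  fix xs ys :: "'v list" assume n: "length xs + length ys + 1 = length \<theta>s"
  define as where "as = take (length xs) \<theta>s"
  obtain \<theta> bs where bs: "drop (length xs) \<theta>s = \<theta> # bs"
    using n by (cases "drop (length xs) \<theta>s") auto
  have eq: "\<theta>s = as @ \<theta> # bs" unfolding as_def bs[symmetric] by simp
  have len: "length as = length xs" unfolding as_def using n by simp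
  have "\<theta> \<in> dual s" using \<theta>s eq by auto
  then have th: "Vector_Spaces.linear s (*) \<theta>" by (simp add: dual_def)
  show "Vector_Spaces.linear s (*)
      (\<lambda>v. prod_list (map2 (\<lambda>\<theta> v. \<theta> v) \<theta>s (xs @ v # ys)))"
    using th unfolding Vector_Spaces.linear_iff eq
    by (simp add: len algebra_simps)
qed

lemma dual_pair_tensor:
  fixes s :: "'f::field \<Rightarrow> 'v::ab_group_add \<Rightarrow> 'v"
  assumes "vector_space s" "set \<theta>s \<subseteq> dual s" "length vs = length \<theta>s"
  shows "dual_pair \<theta>s (tensor s vs) = prod_list (map2 (\<lambda>\<theta> v. \<theta> v) \<theta>s vs)"
  using multilinear_prod[OF assms(1,2)] assms(3) by (simp add: dual_pair_def tensor_def)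

lemma sym_tensor_replicate:
  fixes s :: "'f::field_char_0 \<Rightarrow> 'v::ab_group_add \<Rightarrow> 'v"
  shows "sym_tensor s (replicate n v) = tensor s (replicate n v)"
proof -
  have "permute_list \<pi> (replicate n v) = replicate n v" if "\<pi> permutes {..<n}" for \<pi>
    using that permutes_in_image[OF that] by (intro nth_equalityI) (auto simp: permute_list_def)
  then have "(\<Sum>\<pi> | \<pi> permutes {..<n}. tensor s (permute_list \<pi> (replicate n v)))
      = (\<Sum>\<pi> | \<pi> permutes {..<n}. tensor s (replicate n v))"
    by (intro sum.cong) auto
  also have "\<dots> = of_nat (fact n) * tensor s (replicate n v)"
    by (simp add: card_permutations)
  finally show ?thesis
    by (simp add: sym_tensor_def fscale_def fun_eq_iff of_nat_fun)
qed

lemma dual_pair_replicate: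
  fixes s :: "'f::field_char_0 \<Rightarrow> 'v::ab_group_add \<Rightarrow> 'v"
  assumes "vector_space s" "set \<theta>s \<subseteq> dual s" "length \<theta>s = k"
  shows "dual_pair \<theta>s (sym_tensor s (replicate k v)) = (\<Prod>\<theta>\<leftarrow>\<theta>s. \<theta> v)"
proof -
  have "map2 (\<lambda>\<theta> v. \<theta> v) \<theta>s (replicate k v) = map (\<lambda>\<theta>. \<theta> v) \<theta>s"
    using assms(3) by (intro nth_equalityI) auto
  with assms show ?thesis by (simp add: sym_tensor_replicate dual_pair_tensor)
qed

lemma dual_power_sym_tensor:
  fixes s :: "'f::field_char_0 \<Rightarrow> 'v::ab_group_add \<Rightarrow> 'v"
  assumes "vector_space s" "\<omega> \<in> dual s" "length vs = n"
  shows "dual_power n \<omega> (sym_tensor s vs) = (\<Prod>v\<leftarrow>vs. \<omega> v)"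
proof -
  have t: "dual_power n \<omega> (tensor s ws) = (\<Prod>v\<leftarrow>ws. \<omega> v)" if "length ws = n" for ws
  proof -
    have "map2 (\<lambda>\<theta> v. \<theta> v) (replicate n \<omega>) ws = map \<omega> ws"
      using that by (intro nth_equalityI) auto
    then show ?thesis
      using dual_pair_tensor[OF assms(1), of "replicate n \<omega>" ws] assms(2) that
      by (simp add: dual_power_def set_replicate_conv_if)
  qed
  have p: "(\<Prod>v\<leftarrow>permute_list \<pi> vs. \<omega> v) = (\<Prod>v\<leftarrow>vs. \<omega> v)" if "\<pi> permutes {..<n}" for \<pi>
    using that assms(3) mset_permute_list[of \<pi> vs]
    by (metis mset_map prod_mset_prod_list)
  have sum_apply: "(\<Sum>i\<in>A. g i) m = (\<Sum>i\<in>A. g i m)"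
    for A :: "(nat \<Rightarrow> nat) set" and g :: "(nat \<Rightarrow> nat) \<Rightarrow> ('v, 'f) tensor" and m
    by (induction A rule: infinite_finite_induct) auto
  have "dual_power n \<omega> (sym_tensor s vs)
      = 1 / fact n * (\<Sum>\<pi> | \<pi> permutes {..<n}. dual_power n \<omega> (tensor s (permute_list \<pi> vs)))"
    using assms(3) by (simp add: sym_tensor_def dual_power_def dual_pair_def fscale_def sum_apply)
  also have "(\<Sum>\<pi> | \<pi> permutes {..<n}. dual_power n \<omega> (tensor s (permute_list \<pi> vs)))
      = (\<Sum>\<pi> | \<pi> permutes {..<n}. (\<Prod>v\<leftarrow>vs. \<omega> v))"
    using assms(3) by (intro sum.cong) (auto simp: t p)
  also have "\<dots> = fact n * (\<Prod>v\<leftarrow>vs. \<omega> v)"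
    by (simp add: card_permutations)
  finally show ?thesis by simp
qed

end

theory Submission
  imports Defs
begin

text \<open>
  The theorem is a Taylor formula in which the derivatives are replaced by the lowering operators
  \<open>Q(\<theta>)\<close> and the monomials by the polynomials \<open>P\<^sub>k\<close>:
  \<open>p(\<omega> + \<zeta>) = (\<Sum>k. 1/k! \<langle>P\<^sub>k(\<zeta>), (Q\<^sup>k p)(\<omega>)\<rangle>)\<close>.

  At \<open>\<omega> = 0\<close> the formula comes from \<open>P\<^sub>0 = 1\<close> and \<open>P\<^sub>n(0) = 0\<close> for \<open>n \<ge> 1\<close>: by
  \<open>Q(\<theta>) \<langle>P\<^sub>n, v\<^sup>\<otimes>\<^sup>n\<rangle> = n \<langle>\<theta>, v\<rangle> \<langle>P\<^bsub>n-1\<^esub>, v\<^sup>\<otimes>\<^sup>(\<^sup>n\<^sup>-\<^sup>1\<^sup>)\<rangle>\<close> the value \<open>(Q\<^sup>k \<langle>P\<^sub>n, v\<^sup>\<otimes>\<^sup>n\<rangle>)(0)\<close> is \<open>n! v\<^sup>\<otimes>\<^sup>n\<close> for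
  \<open>k = n\<close> and \<open>0\<close> otherwise, and the polynomials \<open>\<langle>P\<^sub>n, v\<^sup>\<otimes>\<^sup>n\<rangle>\<close> span (\<open>expansion_at_0\<close>).
  Shift-invariance of the \<open>Q(\<theta>)\<close> makes \<open>Q\<^sup>k\<close> commute with shifts (\<open>lowering_power_shift\<close>), which
  moves the formula to an arbitrary \<open>\<omega>\<close> (\<open>taylor_expansion\<close>).

  If \<open>T\<close> is shift-invariant then \<open>(T p)(\<omega>) = (T (p(\<omega> + \<cdot>)))(0)\<close>.  Applying \<open>T\<close> to the Taylor formula
  in the variable \<open>\<zeta>\<close> and evaluating at \<open>0\<close> gives the expansion of \<open>T\<close>, with
  \<open>\<langle>T\<^sub>k, f\<rangle> = 1/k! (T \<langle>P\<^sub>k, f\<rangle>)(0)\<close> (\<open>shift_invariant_imp_expansion\<close>).  Conversely each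
  \<open>\<langle>T\<^sub>k, Q\<^sup>k\<rangle>\<close> commutes with shifts because \<open>Q\<^sup>k\<close> does, and evaluating an expansion on \<open>1\<close> and on
  \<open>\<langle>P\<^sub>k, f\<rangle>\<close> at \<open>0\<close> isolates its coefficients.

  What remains is to see that the objects behave as expected.  Polarization reduces all linear
  statements about \<open>V\<^sup>\<odot>\<^sup>n\<close> to the powers \<open>v\<^sup>\<otimes>\<^sup>n\<close> (\<open>sym_power_eq_span_powers\<close>).  A dual basis shows that
  the products \<open>\<theta>\<^sub>1 \<odot> \<dots> \<odot> \<theta>\<^sub>k\<close> separate the points of \<open>V\<^sup>\<odot>\<^sup>k\<close> (\<open>dual_pair_separates\<close>), which makes \<open>Q\<^sup>k\<close>
  unique; polarization in the dual space then shows that a homogeneous polynomial determines its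
  symmetric tensor (\<open>dual_power_separates\<close>), which makes the triangular operator \<open>P\<close> bijective.
\<close>

section \<open>Polarization\<close>

lemma sum_lists_length_Suc:
  assumes "finite S"
  shows "(\<Sum>js | set js \<subseteq> S \<and> length js = Suc k. g js)
    = (\<Sum>i\<in>S. \<Sum>js | set js \<subseteq> S \<and> length js = k. g (i # js))"
proof -
  have "(\<Sum>js | set js \<subseteq> S \<and> length js = Suc k. g js)
      = (\<Sum>(js, i)\<in>{js. set js \<subseteq> S \<and> length js = k} \<times> S. g (i # js))"
    unfolding lists_length_Suc_eq
    by (subst sum.reindex) (auto simp: inj_on_def case_prod_unfold)
  also have "\<dots> = (\<Sum>js | set js \<subseteq> S \<and> length js = k. \<Sum>i\<in>S. g (i # js))"
    by (simp add: sum.cartesian_product)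
  also have "\<dots> = (\<Sum>i\<in>S. \<Sum>js | set js \<subseteq> S \<and> length js = k. g (i # js))"
    by (rule sum.swap)
  finally show ?thesis .
qed

text \<open>
  Homogeneity under scalars is left out so that the notion applies both to \<open>tensor s\<close> and to
  \<open>prod_list\<close> without reference to a scalar multiplication.
\<close>

definition multiadditive :: "nat \<Rightarrow> ('a::ab_group_add list \<Rightarrow> 'b::ab_group_add) \<Rightarrow> bool"
  where "multiadditive n m \<longleftrightarrow> (\<forall>xs ys x y. length xs + length ys + 1 = n \<longrightarrow>
    m (xs @ (x + y) # ys) = m (xs @ x # ys) + m (xs @ y # ys))"

lemma multiadditive_sum:
  assumes m: "multiadditive n m" and n: "length xs + length ys + 1 = n" and "finite S"
  shows "m (xs @ (\<Sum>i\<in>S. v i) # ys) = (\<Sum>i\<in>S. m (xs @ v i # ys))"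
  using \<open>finite S\<close>
proof (induction S rule: finite_induct)
  case empty
  have "m (xs @ (0 + 0) # ys) = m (xs @ 0 # ys) + m (xs @ 0 # ys)"
    using m n unfolding multiadditive_def by blast
  then show ?case by simp
next
  case (insert i S)
  then show ?case using m n unfolding multiadditive_def by simp
qed

lemma multiadditive_expand:
  assumes m: "multiadditive n m" and "length xs + k = n" and S: "finite S"
  shows "m (xs @ replicate k (\<Sum>i\<in>S. v i))
    = (\<Sum>js | set js \<subseteq> S \<and> length js = k. m (xs @ map v js))"
  using assms(2)
proof (induction k arbitrary: xs)
  case 0
  have "{js. set js \<subseteq> S \<and> length js = 0} = {[]}" by auto
  then show ?case by simp
next
  case (Suc k)
  have "m (xs @ replicate (Suc k) (\<Sum>i\<in>S. v i))
      = (\<Sum>i\<in>S. m ((xs @ [v i]) @ replicate k (\<Sum>i\<in>S. v i)))"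
    using multiadditive_sum[OF m _ S, of xs "replicate k (\<Sum>i\<in>S. v i)" v] Suc.prems by simp
  also have "\<dots> = (\<Sum>i\<in>S. \<Sum>js | set js \<subseteq> S \<and> length js = k. m (xs @ map v (i # js)))"
    using Suc.prems by (intro sum.cong refl, subst Suc.IH) auto
  also have "\<dots> = (\<Sum>js | set js \<subseteq> S \<and> length js = Suc k. m (xs @ map v js))"
    by (rule sum_lists_length_Suc[OF S, symmetric])
  finally show ?case .
qed

text \<open>
  If some \<open>a \<in> N - A\<close> exists, adding and removing \<open>a\<close> pairs the sets \<open>S\<close> with opposite signs.
\<close>

lemma alternating_sum_supersets:
  assumes N: "finite N" and A: "A \<subseteq> N"
  shows "(\<Sum>S | A \<subseteq> S \<and> S \<subseteq> N. (-1 :: 'b::comm_ring_1) ^ (card N + card S)) = (if A = N then 1 else 0)"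
proof (cases "A = N")
  case True
  then have "{S. A \<subseteq> S \<and> S \<subseteq> N} = {N}" by auto
  with True show ?thesis by (simp add: power_add[symmetric] mult_2[symmetric])
next
  case False
  with A obtain a where a: "a \<in> N" "a \<notin> A" by auto
  define X where "X = {S. A \<subseteq> S \<and> S \<subseteq> N - {a}}"
  have fin: "finite X" unfolding X_def using N by (auto intro: finite_subset[of _ "Pow N"])
  have eq: "{S. A \<subseteq> S \<and> S \<subseteq> N} = X \<union> insert a ` X"
  proof (intro equalityI subsetI)
    fix S assume S: "S \<in> {S. A \<subseteq> S \<and> S \<subseteq> N}"
    show "S \<in> X \<union> insert a ` X"
    proof (cases "a \<in> S")
      case True
      then have "S = insert a (S - {a})" "S - {a} \<in> X" using S a by (auto simp: X_def)
      then show ?thesis by blast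
    qed (use S in \<open>auto simp: X_def\<close>)
  qed (use a in \<open>auto simp: X_def\<close>)
  have inj: "inj_on (insert a) X" unfolding X_def by (rule inj_onI) (auto simp: insert_eq_iff)
  have "card (insert a S) = Suc (card S)" if "S \<in> X" for S
    using that N by (subst card_insert_disjoint) (auto simp: X_def intro: finite_subset)
  then have "(\<Sum>S\<in>insert a ` X. (-1 :: 'b) ^ (card N + card S)) = (\<Sum>S\<in>X. - ((-1) ^ (card N + card S)))"
    by (subst sum.reindex[OF inj]) (auto intro!: sum.cong)
  moreover have "X \<inter> insert a ` X = {}" by (auto simp: X_def)
  ultimately show ?thesis
    using False fin by (simp add: eq sum.union_disjoint sum_negf)
qed

text \<open>
  Expanding \<open>m\<close> by additivity turns the left-hand side into a signed sum over index lists \<open>js\<close> and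
  sets \<open>S \<supseteq> set js\<close>.  Summation over \<open>S\<close> cancels all lists that miss an index, and the lists of
  length \<open>n\<close> that hit all \<open>n\<close> indices are the permutations.
\<close>

lemma polarization:
  fixes m :: "'a::ab_group_add list \<Rightarrow> 'b::comm_ring_1"
  assumes m: "multiadditive n m" and n: "length vs = n"
  shows "(\<Sum>S\<in>Pow {..<n}. (-1) ^ (n + card S) * m (replicate n (\<Sum>i\<in>S. vs ! i)))
    = (\<Sum>\<pi> | \<pi> permutes {..<n}. m (permute_list \<pi> vs))"
proof -
  let ?N = "{..<n}" and ?m = "\<lambda>js. m (map ((!) vs) js)"
  let ?L = "\<lambda>S. {js. set js \<subseteq> S \<and> length js = n}"
  have finL: "finite (?L ?N)" by (simp add: finite_lists_length_eq)
  have "(\<Sum>S\<in>Pow ?N. (-1) ^ (n + card S) * m (replicate n (\<Sum>i\<in>S. vs ! i)))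
      = (\<Sum>S\<in>Pow ?N. \<Sum>js\<in>?L ?N. if set js \<subseteq> S then (-1) ^ (n + card S) * ?m js else 0)"
  proof (intro sum.cong refl)
    fix S assume S: "S \<in> Pow ?N"
    then have "finite S" by (auto intro: finite_subset)
    then have "m (replicate n (\<Sum>i\<in>S. vs ! i)) = (\<Sum>js\<in>?L S. ?m js)"
      using multiadditive_expand[OF m, of "[]" n S "(!) vs"] by simp
    also have "?L S = ?L ?N \<inter> {js. set js \<subseteq> S}" using S by auto
    finally show "(-1) ^ (n + card S) * m (replicate n (\<Sum>i\<in>S. vs ! i))
      = (\<Sum>js\<in>?L ?N. if set js \<subseteq> S then (-1) ^ (n + card S) * ?m js else 0)"
      by (simp add: sum_distrib_left sum.inter_restrict[OF finL] if_distrib cong: if_cong)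
  qed
  also have "\<dots> = (\<Sum>js\<in>?L ?N. \<Sum>S\<in>Pow ?N. if set js \<subseteq> S then (-1) ^ (n + card S) * ?m js else 0)"
    by (rule sum.swap)
  also have "\<dots> = (\<Sum>js\<in>?L ?N. if set js = ?N then ?m js else 0)"
  proof (intro sum.cong refl)
    fix js assume js: "js \<in> ?L ?N"
    have "(\<Sum>S\<in>Pow ?N. if set js \<subseteq> S then (-1) ^ (n + card S) * ?m js else 0)
        = (\<Sum>S\<in>Pow ?N \<inter> {S. set js \<subseteq> S}. (-1) ^ (n + card S) * ?m js)"
      by (simp add: sum.inter_restrict)
    also have "Pow ?N \<inter> {S. set js \<subseteq> S} = {S. set js \<subseteq> S \<and> S \<subseteq> ?N}" by auto
    also have "(\<Sum>S\<in>\<dots>. (-1) ^ (n + card S) * ?m js) = (if set js = ?N then ?m js else 0)"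
      using alternating_sum_supersets[of ?N "set js", where 'b='b] js
      by (simp add: sum_distrib_right[symmetric])
    finally show "(\<Sum>S\<in>Pow ?N. if set js \<subseteq> S then (-1) ^ (n + card S) * ?m js else 0)
        = (if set js = ?N then ?m js else 0)" .
  qed
  also have "\<dots> = (\<Sum>js | length js = n \<and> set js = ?N. ?m js)"
    using finL by (subst sum.inter_filter[symmetric]) (auto intro!: sum.cong)
  also have "\<dots> = (\<Sum>\<pi> | \<pi> permutes ?N. m (permute_list \<pi> vs))"
  proof (rule sum.reindex_bij_witness[of _ "\<lambda>\<pi>. map \<pi> [0..<n]" "\<lambda>js i. if i < n then js ! i else i"])
    fix js assume "js \<in> {js. length js = n \<and> set js = ?N}"
    then have len: "length js = n" and set: "set js = ?N" by simp_all
    let ?p = "\<lambda>i. if i < n then js ! i else i"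
    show "map ?p [0..<n] = js" using len by (intro nth_equalityI) simp_all
    have "distinct js" by (rule card_distinct) (simp only: len set card_lessThan)
    then have "bij_betw ((!) js) ?N ?N"
      by (rule bij_betw_nth) (simp_all only: len set)
    then have "bij_betw ?p ?N ?N"
      by (subst bij_betw_cong[where g = "(!) js"]) simp_all
    then show "?p \<in> {\<pi>. \<pi> permutes ?N}"
      by (intro CollectI bij_imp_permutes) simp_all
    have "permute_list ?p vs = map ((!) vs) js"
      using len n by (intro nth_equalityI) (simp_all add: permute_list_def)
    then show "m (permute_list ?p vs) = ?m js" by (rule arg_cong)
  next
    fix \<pi> assume \<pi>: "\<pi> \<in> {\<pi>. \<pi> permutes ?N}"
    then show "(\<lambda>i. if i < n then map \<pi> [0..<n] ! i else i) = \<pi>"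
      by (auto simp: fun_eq_iff permutes_def)
    show "map \<pi> [0..<n] \<in> {js. length js = n \<and> set js = ?N}"
      using \<pi> permutes_image[of \<pi> ?N] by (auto simp: atLeast0LessThan)
  qed
  finally show ?thesis .
qed

text \<open>
  The case \<open>m = prod_list\<close>, which is symmetric, so that all permutations contribute equally.
\<close>

lemma polarization_prod_list:
  fixes xs :: "'f::field_char_0 list"
  shows "(\<Sum>S\<in>Pow {..<length xs}. (-1) ^ (length xs + card S) * (\<Sum>i\<in>S. xs ! i) ^ length xs)
    = fact (length xs) * prod_list xs"
proof -
  have "multiadditive (length xs) (prod_list :: 'f list \<Rightarrow> 'f)"
    by (simp add: multiadditive_def algebra_simps)
  from polarization[OF this refl]
  have "(\<Sum>S\<in>Pow {..<length xs}. (-1) ^ (length xs + card S) * (\<Sum>i\<in>S. xs ! i) ^ length xs)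
    = (\<Sum>\<pi> | \<pi> permutes {..<length xs}. prod_list (permute_list \<pi> xs))" by simp
  also have "\<dots> = (\<Sum>\<pi> | \<pi> permutes {..<length xs}. prod_list xs)"
  proof (intro sum.cong refl)
    fix \<pi> assume "\<pi> \<in> {\<pi>. \<pi> permutes {..<length xs}}"
    then have "mset (permute_list \<pi> xs) = mset xs" by (simp add: mset_permute_list)
    then show "prod_list (permute_list \<pi> xs) = prod_list xs" by (simp flip: prod_mset_prod_list)
  qed
  finally show ?thesis by (simp add: card_permutations)
qed


section \<open>Symmetric tensors and their functionals\<close>

interpretation fs: vector_space "fscale :: 'f::field \<Rightarrow> ('x \<Rightarrow> 'f) \<Rightarrow> 'x \<Rightarrow> 'f"
  by (rule vector_space_fscale)

text \<open>
  Polynomials, tensors and functionals are treated as vectors: their sums and zeros stay folded,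
  and evaluation at a point is requested through the collection \<open>pointwise\<close>.
\<close>

declare plus_fun_apply [simp del] zero_fun_apply [simp del] times_fun_apply [simp del]
  one_fun_apply [simp del] minus_apply [simp del] uminus_apply [simp del]

lemma vector_space_mult: "vector_space ((*) :: 'f::field \<Rightarrow> 'f \<Rightarrow> 'f)"
  by unfold_locales (auto simp: algebra_simps)

lemma fscale_apply: "fscale c f x = c * f x"
  by (simp add: fscale_def)

lemmas pointwise = plus_fun_apply zero_fun_apply times_fun_apply one_fun_apply minus_apply
  uminus_apply fscale_apply

lemma sum_fun_apply: "(\<Sum>i\<in>A. g i) x = (\<Sum>i\<in>A. g i x)"
  by (induction A rule: infinite_finite_induct) (auto simp: pointwise)

lemma linear_on_zero:
  assumes "linear_on s1 s2 U W L" "0 \<in> U"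
  shows "L 0 = 0"
proof -
  have "L (0 + 0) = L 0 + L 0" using assms unfolding linear_on_def by blast
  then show ?thesis by simp
qed

lemma linear_on_sum:
  assumes L: "linear_on fscale s2 U W L" and U: "fs.subspace U" and x: "\<And>i. i \<in> A \<Longrightarrow> x i \<in> U"
  shows "L (\<Sum>i\<in>A. x i) = (\<Sum>i\<in>A. L (x i))"
  using x
proof (induction A rule: infinite_finite_induct)
  case (insert a A)
  then show ?case
    using L fs.subspace_sum[OF U, of A x] unfolding linear_on_def by simp
qed (use linear_on_zero[OF L fs.subspace_0[OF U]] in auto)

definition tpow :: "('f::field \<Rightarrow> 'v::ab_group_add \<Rightarrow> 'v) \<Rightarrow> nat \<Rightarrow> 'v \<Rightarrow> ('v, 'f) tensor"
  where "tpow s n v = tensor s (replicate n v)"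

lemma dual_pair_linear [simp]:
  "dual_pair \<theta>s (f + g) = dual_pair \<theta>s f + dual_pair \<theta>s g"
  "dual_pair \<theta>s (fscale c f) = c * dual_pair \<theta>s f"
  "dual_pair \<theta>s 0 = 0"
  by (simp_all add: dual_pair_def pointwise)

lemma dual_power_linear [simp]:
  "dual_power n \<omega> (f + g) = dual_power n \<omega> f + dual_power n \<omega> g"
  "dual_power n \<omega> (fscale c f) = c * dual_power n \<omega> f"
  "dual_power n \<omega> 0 = 0"
  by (simp_all add: dual_power_def)

lemma dual_pair_diff: "dual_pair \<theta>s (f - g) = dual_pair \<theta>s f - dual_pair \<theta>s g"
  by (simp add: dual_pair_def pointwise)

lemma dual_closed:
  assumes "vector_space s"
  shows "0 \<in> dual s" "\<theta> \<in> dual s \<Longrightarrow> \<eta> \<in> dual s \<Longrightarrow> \<theta> + \<eta> \<in> dual s"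
    "\<theta> \<in> dual s \<Longrightarrow> fscale c \<theta> \<in> dual s"
  using assms vector_space_mult
  by (auto simp: dual_def Vector_Spaces.linear_iff pointwise algebra_simps)

lemma subspace_dual:
  assumes "vector_space s"
  shows "fs.subspace (dual s)"
  using dual_closed[OF assms] by (auto intro: fs.subspaceI)

locale dual_space = vector_space s
  for s :: "'f::real_normed_field \<Rightarrow> 'v::ab_group_add \<Rightarrow> 'v"
begin

lemma multiadditive_tensor: "multiadditive n (tensor s)"
  using multilinear_tensor[OF vector_space_axioms, of n]
  by (auto simp: multiadditive_def multilinear_def Vector_Spaces.linear_iff)

text \<open>
  Polarization writes the symmetrization of \<open>v\<^sub>1 \<otimes> \<dots> \<otimes> v\<^sub>n\<close> as a combination of the powers of the
  partial sums of \<open>v\<^sub>1, \<dots>, v\<^sub>n\<close>.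
\<close>

lemma sym_power_eq_span_powers: "sym_power s n = fs.span (range (tpow s n))"
proof
  have "sym_tensor s vs \<in> fs.span (range (tpow s n))" if n: "length vs = n" for vs
  proof -
    have "(-1) ^ (n + card S) * tensor s (replicate n (\<Sum>i\<in>S. vs ! i)) \<in> fs.span (range (tpow s n))" for S
    proof -
      have "tensor s (replicate n (\<Sum>i\<in>S. vs ! i)) \<in> fs.span (range (tpow s n))"
        by (intro fs.span_base) (simp add: tpow_def)
      then show ?thesis by (cases "even (n + card S)") (simp_all add: fs.span_neg del: even_add)
    qed
    then have "(\<Sum>\<pi> | \<pi> permutes {..<n}. tensor s (permute_list \<pi> vs)) \<in> fs.span (range (tpow s n))"
      unfolding polarization[OF multiadditive_tensor n, symmetric] by (intro fs.span_sum)
    then show ?thesis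
      using n by (auto simp: sym_tensor_def intro: fs.span_scale)
  qed
  then show "sym_power s n \<subseteq> fs.span (range (tpow s n))"
    unfolding sym_power_def by (intro fs.span_minimal) auto
  show "fs.span (range (tpow s n)) \<subseteq> sym_power s n"
    unfolding sym_power_def
  proof (rule fs.span_mono, safe)
    fix v
    show "\<exists>vs. tpow s n v = sym_tensor s vs \<and> length vs = n"
      by (rule exI[of _ "replicate n v"]) (simp add: tpow_def sym_tensor_replicate)
  qed
qed

lemma subspace_sym_power: "fs.subspace (sym_power s n)"
  by (simp add: sym_power_def)

lemma tpow_in_sym_power: "tpow s n v \<in> sym_power s n"
  by (simp add: sym_power_eq_span_powers fs.span_base)

lemma dual_pair_tpow:
  assumes "set \<theta>s \<subseteq> dual s" "length \<theta>s = n"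
  shows "dual_pair \<theta>s (tpow s n v) = (\<Prod>\<theta>\<leftarrow>\<theta>s. \<theta> v)"
  using dual_pair_replicate[OF vector_space_axioms assms] by (simp add: tpow_def sym_tensor_replicate)

lemma dual_power_tpow:
  assumes "\<omega> \<in> dual s"
  shows "dual_power n \<omega> (tpow s n v) = \<omega> v ^ n"
  using assms dual_pair_tpow[of "replicate n \<omega>" n v]
  by (simp add: dual_power_def set_replicate_conv_if)

text \<open>
  Polarization in the dual space.  By linearity in \<open>f\<close> it suffices to take \<open>f = v\<^sup>\<otimes>\<^sup>n\<close>, where it is
  the scalar polarization identity for the numbers \<open>\<langle>\<theta>\<^sub>i, v\<rangle>\<close>.
\<close>

lemma dual_pair_polarization:
  assumes f: "f \<in> sym_power s n" and \<theta>s: "set \<theta>s \<subseteq> dual s" "length \<theta>s = n"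
  shows "(\<Sum>S\<in>Pow {..<n}. (-1) ^ (n + card S) * dual_power n (\<Sum>i\<in>S. \<theta>s ! i) f)
    = fact n * dual_pair \<theta>s f"
  using f unfolding sym_power_eq_span_powers
proof (induction rule: fs.span_induct_alt)
  case base
  show ?case by simp
next
  case (step c x y)
  then obtain v where v: "x = tpow s n v" by auto
  have "dual_power n (\<Sum>i\<in>S. \<theta>s ! i) x = (\<Sum>i\<in>S. map (\<lambda>\<theta>. \<theta> v) \<theta>s ! i) ^ n" if "S \<in> Pow {..<n}" for S
  proof -
    have "(\<Sum>i\<in>S. \<theta>s ! i) \<in> dual s"
      using that \<theta>s by (intro fs.subspace_sum[OF subspace_dual[OF vector_space_axioms]]) (auto simp: subset_iff)
    moreover have "(\<Sum>i\<in>S. (\<theta>s ! i) v) = (\<Sum>i\<in>S. map (\<lambda>\<theta>. \<theta> v) \<theta>s ! i)"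
      using that \<theta>s by (intro sum.cong) auto
    ultimately show ?thesis by (simp add: v dual_power_tpow sum_fun_apply)
  qed
  then have "(\<Sum>S\<in>Pow {..<n}. (-1) ^ (n + card S) * dual_power n (\<Sum>i\<in>S. \<theta>s ! i) x)
    = fact n * dual_pair \<theta>s x"
    using polarization_prod_list[of "map (\<lambda>\<theta>. \<theta> v) \<theta>s"] \<theta>s by (simp add: v dual_pair_tpow)
  with step show ?case
    by (simp add: algebra_simps sum.distrib flip: sum_distrib_left)
qed

text \<open>
  The prefix \<open>xs\<close> collects the entries already replaced by basis vectors, so that the induction
  treats one entry at a time.
\<close>

lemma tensor_in_span_basis_tensors:
  assumes B: "span B = UNIV" and "set xs \<subseteq> B" "length xs + length ys = k"
  shows "tensor s (xs @ ys) \<in> fs.span {tensor s bs |bs. set bs \<subseteq> B \<and> length bs = k}" (is "_ \<in> ?T")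
  using assms(2,3)
proof (induction ys arbitrary: xs)
  case Nil
  have "tensor s (xs @ []) \<in> {tensor s bs |bs. set bs \<subseteq> B \<and> length bs = k}"
    using Nil by (intro CollectI exI[of _ xs]) simp
  then show ?case by (rule fs.span_base)
next
  case (Cons y ys)
  have lin: "Vector_Spaces.linear s fscale (\<lambda>v. tensor s (xs @ v # ys))"
    using multilinear_tensor[OF vector_space_axioms, of k] Cons.prems by (simp add: multilinear_def)
  have L0: "tensor s (xs @ 0 # ys) = 0"
    using lin unfolding Vector_Spaces.linear_iff by (metis add_cancel_right_left)
  from lin have "subspace {v. tensor s (xs @ v # ys) \<in> ?T}"
    using L0 by (intro subspaceI)
      (auto simp: Vector_Spaces.linear_iff intro: fs.span_add fs.span_scale fs.span_zero)
  moreover have "tensor s (xs @ v # ys) \<in> ?T" if "v \<in> B" for v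
    using Cons.IH[of "xs @ [v]"] Cons.prems that by simp
  ultimately show ?case
    using span_induct[of y B "\<lambda>v. tensor s (xs @ v # ys) \<in> ?T"] B by auto
qed

lemma dual_basis_exists:
  assumes "independent B"
  obtains \<delta> where "\<And>b. b \<in> B \<Longrightarrow> \<delta> b \<in> dual s" "\<And>b c. b \<in> B \<Longrightarrow> c \<in> B \<Longrightarrow> \<delta> b c = (if c = b then 1 else 0)"
proof -
  interpret F: vector_space "(*) :: 'f \<Rightarrow> 'f \<Rightarrow> 'f" by (rule vector_space_mult)
  interpret VF: vector_space_pair s "(*) :: 'f \<Rightarrow> 'f \<Rightarrow> 'f" ..
  have "\<exists>g. g \<in> dual s \<and> (\<forall>c\<in>B. g c = (if c = b then 1 else 0))" for b
    using VF.linear_independent_extend[OF assms, of "\<lambda>c. if c = b then 1 else 0"]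
    by (auto simp: dual_def)
  then show ?thesis using that by metis
qed

text \<open>
  Expand \<open>f\<close> in the tensors of basis vectors; the products of the dual basis functionals read off
  the coefficients.  Only finitely many basis vectors occur, so \<open>V\<close> may have any dimension.
\<close>

lemma dual_pair_separates:
  assumes f: "f \<in> sym_power s k"
    and 0: "\<And>\<theta>s. set \<theta>s \<subseteq> dual s \<Longrightarrow> length \<theta>s = k \<Longrightarrow> dual_pair \<theta>s f = 0"
  shows "f = 0"
proof -
  obtain B where B: "independent B" "span B = UNIV"
    using maximal_independent_subset[of UNIV] by (metis top.extremum_uniqueI)
  obtain \<delta> where \<delta>: "\<And>b. b \<in> B \<Longrightarrow> \<delta> b \<in> dual s"
      "\<And>b c. b \<in> B \<Longrightarrow> c \<in> B \<Longrightarrow> \<delta> b c = (if c = b then 1 else 0)"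
    using dual_basis_exists[OF B(1)] by metis
  let ?T = "{tensor s bs |bs. set bs \<subseteq> B \<and> length bs = k}"
  have \<delta>s: "set (map \<delta> bs) \<subseteq> dual s" if "set bs \<subseteq> B" for bs
    using that \<delta>(1) by auto
  have pair: "dual_pair (map \<delta> bs) (tensor s as) = (if as = bs then 1 else 0)"
    if "set bs \<subseteq> B" "set as \<subseteq> B" "length bs = k" "length as = k" for as bs
  proof -
    have "length as = length bs \<Longrightarrow> set bs \<subseteq> B \<Longrightarrow> set as \<subseteq> B \<Longrightarrow>
      prod_list (map2 (\<lambda>\<theta> v. \<theta> v) (map \<delta> bs) as) = (if as = bs then 1 else 0)"
      by (induction as bs rule: list_induct2) (auto simp: \<delta>(2))
    then show ?thesis using that \<delta>s by (subst dual_pair_tensor[OF vector_space_axioms]) auto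
  qed
  have "tpow s k v \<in> fs.span ?T" for v
    using tensor_in_span_basis_tensors[OF B(2), of "[]" "replicate k v" k] by (simp add: tpow_def)
  then have "f \<in> fs.span ?T"
    using f fs.span_minimal[of "range (tpow s k)" "fs.span ?T"]
    unfolding sym_power_eq_span_powers by auto
  then obtain t r where t: "finite t" "t \<subseteq> ?T" and f_eq: "f = (\<Sum>a\<in>t. fscale (r a) a)"
    unfolding fs.span_explicit by blast
  have "r a = 0" if a: "a \<in> t" for a
  proof -
    obtain bs where bs: "a = tensor s bs" "set bs \<subseteq> B" "length bs = k" using a t by blast
    \<comment> \<open>Different lists of basis vectors give different tensors, as the dual functionals show.\<close>
    have "dual_pair (map \<delta> bs) a' = (if a' = a then 1 else 0)" if a': "a' \<in> t" for a'
    proof -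
      obtain as where as: "a' = tensor s as" "set as \<subseteq> B" "length as = k" using a' t by blast
      have "as = bs \<longleftrightarrow> a' = a"
        using pair[OF bs(2) as(2) bs(3) as(3)] pair[OF bs(2) bs(2) bs(3) bs(3)] as(1) bs(1)
        by (auto split: if_splits)
      then show ?thesis using pair[OF bs(2) as(2) bs(3) as(3)] as(1) by simp
    qed
    then have "(\<Sum>a'\<in>t. r a' * dual_pair (map \<delta> bs) a') = (\<Sum>a'\<in>t. if a' = a then r a' else 0)"
      by (intro sum.cong) auto
    moreover have "dual_pair (map \<delta> bs) f = (\<Sum>a'\<in>t. r a' * dual_pair (map \<delta> bs) a')"
      by (simp add: f_eq dual_pair_def sum_fun_apply fscale_apply)
    ultimately show ?thesis
      using 0[OF \<delta>s[OF bs(2)]] bs(3) t(1) a by simp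
  qed
  then show "f = 0" by (simp add: f_eq)
qed

text \<open>
  By polarization the values of \<open>f\<close> on the powers \<open>\<omega>\<^sup>\<otimes>\<^sup>n\<close> determine its values on all products
  \<open>\<theta>\<^sub>1 \<odot> \<dots> \<odot> \<theta>\<^sub>n\<close>.
\<close>

lemma dual_power_separates:
  assumes f: "f \<in> sym_power s n" and 0: "\<And>\<omega>. \<omega> \<in> dual s \<Longrightarrow> dual_power n \<omega> f = 0"
  shows "f = 0"
proof (rule dual_pair_separates[OF f])
  fix \<theta>s assume \<theta>s: "set \<theta>s \<subseteq> dual s" "length \<theta>s = n"
  have *: "dual_power n (\<Sum>i\<in>S. \<theta>s ! i) f = 0" if "S \<in> Pow {..<n}" for S
    using that \<theta>s by (intro 0 fs.subspace_sum[OF subspace_dual[OF vector_space_axioms]]) (auto simp: subset_iff)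
  then show "dual_pair \<theta>s f = 0"
    using dual_pair_polarization[OF f \<theta>s] by (simp only: * mult_zero_right sum.neutral_const cong: sum.cong) simp
qed

end


section \<open>Polynomials on the dual space\<close>

lemma mono_poly_add: "mono_poly s n (f + g) = mono_poly s n f + mono_poly s n g"
  by (auto simp: mono_poly_def fun_eq_iff pointwise)

lemma mono_poly_fscale: "mono_poly s n (fscale c f) = fscale c (mono_poly s n f)"
  by (auto simp: mono_poly_def fun_eq_iff pointwise)

lemma mono_poly_zero [simp]: "mono_poly s n 0 = 0"
  by (auto simp: mono_poly_def fun_eq_iff pointwise)

lemma shift_add: "shift \<theta> (p + q) = shift \<theta> p + shift \<theta> q"
  by (simp add: shift_def fun_eq_iff pointwise)

lemma shift_fscale: "shift \<theta> (fscale c p) = fscale c (shift \<theta> p)"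
  by (simp add: shift_def fun_eq_iff pointwise)

lemma shift_zero [simp]: "shift \<theta> 0 = 0"
  by (simp add: shift_def fun_eq_iff pointwise)

lemma shift_sum: "shift \<theta> (\<Sum>i\<in>A. p i) = (\<Sum>i\<in>A. shift \<theta> (p i))"
  by (simp add: shift_def fun_eq_iff sum_fun_apply)

context dual_space begin

lemma mono_poly_tpow: "mono_poly s n (tpow s n v) \<omega> = (if \<omega> \<in> dual s then \<omega> v ^ n else 0)"
  by (simp add: mono_poly_def dual_power_tpow)

lemma add_in_dual_iff:
  assumes "\<theta> \<in> dual s"
  shows "\<omega> + \<theta> \<in> dual s \<longleftrightarrow> \<omega> \<in> dual s"
  using fs.subspace_add[OF subspace_dual[OF vector_space_axioms] _ assms, of \<omega>]
    fs.subspace_diff[OF subspace_dual[OF vector_space_axioms] _ assms, of "\<omega> + \<theta>"] by auto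

text \<open>
  The filtration by degree; it carries the triangularity of the operators in \<open>seq_operators\<close>.
\<close>

definition polys_lt :: "nat \<Rightarrow> (('v \<Rightarrow> 'f) \<Rightarrow> 'f) set"
  where "polys_lt n = fs.span {mono_poly s k (tpow s k v) |k v. k < n}"

lemma subspace_polys_lt: "fs.subspace (polys_lt n)"
  by (simp add: polys_lt_def)

lemma polys_lt_mono: "m \<le> n \<Longrightarrow> polys_lt m \<subseteq> polys_lt n"
  unfolding polys_lt_def by (intro fs.span_mono) force

lemma mono_poly_in_polys_lt:
  assumes "f \<in> sym_power s k" "k < n"
  shows "mono_poly s k f \<in> polys_lt n"
  using assms(1) unfolding sym_power_eq_span_powers
proof (induction rule: fs.span_induct_alt)
  case base
  show ?case by (simp add: fs.subspace_0[OF subspace_polys_lt])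
next
  case (step c x y)
  have "mono_poly s k x \<in> polys_lt n"
    unfolding polys_lt_def using step.hyps assms(2) by (intro fs.span_base) auto
  then show ?case
    using step.IH fs.subspace_add[OF subspace_polys_lt] fs.subspace_scale[OF subspace_polys_lt]
    by (simp add: mono_poly_add mono_poly_fscale)
qed

lemma polys_lt_expand:
  assumes "p \<in> polys_lt n"
  obtains f where "\<And>k. f k \<in> sym_power s k" "p = (\<Sum>k<n. mono_poly s k (f k))"
proof -
  have "\<exists>f. (\<forall>k. f k \<in> sym_power s k) \<and> p = (\<Sum>k<n. mono_poly s k (f k))"
    using assms unfolding polys_lt_def
  proof (induction rule: fs.span_induct_alt)
    case base
    show ?case by (rule exI[of _ "\<lambda>_. 0"]) (simp add: fs.subspace_0[OF subspace_sym_power])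
  next
    case (step c x y)
    then obtain j v f where j: "x = mono_poly s j (tpow s j v)" "j < n"
      and f: "\<And>k. f k \<in> sym_power s k" "y = (\<Sum>k<n. mono_poly s k (f k))" by blast
    let ?h = "\<lambda>k. if k = j then fscale c (tpow s j v) else 0"
    have h: "?h k \<in> sym_power s k" for k
      using tpow_in_sym_power[of j v] subspace_sym_power
      by (auto intro: fs.subspace_scale fs.subspace_0)
    have "(\<Sum>k<n. mono_poly s k (?h k)) = (\<Sum>k<n. if k = j then fscale c x else 0)"
      by (intro sum.cong refl) (simp add: j mono_poly_fscale)
    also have "\<dots> = fscale c x" using j by simp
    finally have "fscale c x + y = (\<Sum>k<n. mono_poly s k (?h k + f k))"
      by (simp only: mono_poly_add sum.distrib f(2))
    then show ?case
      using h f(1) fs.subspace_add[OF subspace_sym_power]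
      by (intro exI[of _ "\<lambda>k. ?h k + f k"]) blast
  qed
  then show ?thesis using that by blast
qed

lemma polys_eq_UN: "polys s = (\<Union>n. polys_lt n)"
proof (intro equalityI subsetI)
  fix p assume "p \<in> polys s"
  then obtain n f where "\<forall>k\<le>n. f k \<in> sym_power s k" "p = (\<Sum>k\<le>n. mono_poly s k (f k))"
    unfolding polys_def by blast
  then have "p \<in> polys_lt (Suc n)"
    by (auto intro!: fs.subspace_sum[OF subspace_polys_lt] mono_poly_in_polys_lt)
  then show "p \<in> (\<Union>n. polys_lt n)" by blast
next
  fix p assume "p \<in> (\<Union>n. polys_lt n)"
  then obtain n where "p \<in> polys_lt n" by blast
  then have "p \<in> polys_lt (Suc n)" using polys_lt_mono[of n "Suc n"] by auto
  then obtain f where "\<And>k. f k \<in> sym_power s k" "p = (\<Sum>k<Suc n. mono_poly s k (f k))"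
    using polys_lt_expand by metis
  then show "p \<in> polys s" unfolding polys_def lessThan_Suc_atMost by blast
qed

lemma polys_eq_span: "polys s = fs.span {mono_poly s k (tpow s k v) |k v. True}"
proof
  show "polys s \<subseteq> fs.span {mono_poly s k (tpow s k v) |k v. True}"
    unfolding polys_eq_UN polys_lt_def by (intro UN_least fs.span_mono) blast
  show "fs.span {mono_poly s k (tpow s k v) |k v. True} \<subseteq> polys s"
  proof (rule fs.span_minimal)
    show "fs.subspace (polys s)"
    proof (rule fs.subspaceI)
      show "0 \<in> polys s" using fs.subspace_0[OF subspace_polys_lt] by (auto simp: polys_eq_UN)
    next
      fix p q assume "p \<in> polys s" "q \<in> polys s"
      then obtain m n where "p \<in> polys_lt m" "q \<in> polys_lt n" by (auto simp: polys_eq_UN)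
      then have "p \<in> polys_lt (max m n)" "q \<in> polys_lt (max m n)"
        using polys_lt_mono[of m "max m n"] polys_lt_mono[of n "max m n"] by auto
      then show "p + q \<in> polys s"
        using fs.subspace_add[OF subspace_polys_lt] by (auto simp: polys_eq_UN)
    next
      fix c p assume "p \<in> polys s"
      then show "fscale c p \<in> polys s"
        using fs.subspace_scale[OF subspace_polys_lt] by (auto simp: polys_eq_UN)
    qed
    show "{mono_poly s k (tpow s k v) |k v. True} \<subseteq> polys s"
      using mono_poly_in_polys_lt[OF tpow_in_sym_power lessI] by (auto simp: polys_eq_UN)
  qed
qed

lemma subspace_polys: "fs.subspace (polys s)"
  by (simp add: polys_eq_span)

lemma mono_poly_in_polys: "f \<in> sym_power s k \<Longrightarrow> mono_poly s k f \<in> polys s"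
  using mono_poly_in_polys_lt[OF _ lessI] by (auto simp: polys_eq_UN)

lemma polys_induct [consumes 1, case_names zero step]:
  assumes "p \<in> polys s" and "R 0"
    and "\<And>c n v q. q \<in> polys s \<Longrightarrow> R q \<Longrightarrow> R (fscale c (mono_poly s n (tpow s n v)) + q)"
  shows "R p"
proof -
  have "p \<in> polys s \<and> R p"
    using assms(1) unfolding polys_eq_span
  proof (induction rule: fs.span_induct_alt)
    case base
    show ?case using assms(2) by (simp add: fs.span_zero)
  next
    case (step c x y)
    then obtain n v where x: "x = mono_poly s n (tpow s n v)" by blast
    have "fscale c x + y \<in> fs.span {mono_poly s k (tpow s k v) |k v. True}"
      using step.hyps step.IH by (intro fs.span_add fs.span_scale) (auto intro: fs.span_base)
    then show ?case
      using step assms(3)[of y c n v] by (simp add: x polys_eq_span)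
  qed
  then show ?thesis ..
qed

lemma polys_outside_dual:
  assumes "p \<in> polys s" "\<omega> \<notin> dual s"
  shows "p \<omega> = 0"
  using assms(1) by (induction rule: polys_induct) (simp_all add: pointwise mono_poly_tpow assms(2))

lemma mono_poly_homogeneous:
  assumes "f \<in> sym_power s n" "\<omega> \<in> dual s"
  shows "mono_poly s n f (fscale t \<omega>) = mono_poly s n f \<omega> * t ^ n"
  using assms(1) unfolding sym_power_eq_span_powers
proof (induction rule: fs.span_induct_alt)
  case base
  show ?case by (simp only: mono_poly_zero) (simp add: zero_fun_apply)
next
  case (step c x y)
  have lin: "mono_poly s n (fscale c x + y) \<eta> = c * mono_poly s n x \<eta> + mono_poly s n y \<eta>" for \<eta>
    by (simp add: mono_poly_add mono_poly_fscale pointwise)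
  obtain v where x: "x = tpow s n v" using step.hyps by blast
  have "mono_poly s n x (fscale t \<omega>) = mono_poly s n x \<omega> * t ^ n"
    using assms(2) dual_closed(3)[OF vector_space_axioms assms(2)]
    by (simp add: x mono_poly_tpow fscale_apply power_mult_distrib mult.commute)
  then show ?case by (simp only: lin step.IH) (simp add: algebra_simps)
qed

lemma polys_lt_along_line:
  assumes "p \<in> polys_lt n" "\<omega> \<in> dual s"
  shows "\<exists>c. \<forall>t. p (fscale t \<omega>) = (\<Sum>i<n. c i * t ^ i)"
proof -
  obtain f where f: "\<And>k. f k \<in> sym_power s k" "p = (\<Sum>k<n. mono_poly s k (f k))"
    using polys_lt_expand[OF assms(1)] by metis
  show ?thesis
    by (rule exI[of _ "\<lambda>k. mono_poly s k (f k) \<omega>"])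
      (simp only: f(2) sum_fun_apply mono_poly_homogeneous[OF f(1) assms(2)] simp_thms)
qed

text \<open>
  Along the line \<open>t \<mapsto> t \<omega>\<close> \<open>mono_poly s n f\<close> is a multiple of \<open>t\<^sup>n\<close>, while elements of
  \<open>polys_lt n\<close> have degree less than \<open>n\<close> in \<open>t\<close>.  Hence \<open>\<langle>\<omega>\<^sup>\<otimes>\<^sup>n, f\<rangle> = 0\<close> for all \<open>\<omega>\<close>.  This
  yields the uniqueness of the homogeneous parts of a polynomial.
\<close>

lemma homogeneous_in_polys_lt_imp_zero:
  assumes f: "f \<in> sym_power s n" and m: "mono_poly s n f \<in> polys_lt n"
  shows "f = 0"
proof (rule dual_power_separates[OF f])
  fix \<omega> assume \<omega>: "\<omega> \<in> dual s"
  obtain c where c: "\<And>t. mono_poly s n f (fscale t \<omega>) = (\<Sum>i<n. c i * t ^ i)"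
    using polys_lt_along_line[OF m \<omega>] by blast
  have "mono_poly s n f (fscale t \<omega>) = mono_poly s n f \<omega> * t ^ n" for t
    by (rule mono_poly_homogeneous[OF f \<omega>])
  then have "(\<Sum>i\<le>n. (if i < n then c i else - mono_poly s n f \<omega>) * t ^ i) = 0" for t
    using c[of t] by (simp flip: lessThan_Suc_atMost)
  then have "- mono_poly s n f \<omega> = 0"
    using polyfun_eq_0[of "\<lambda>i. if i < n then c i else - mono_poly s n f \<omega>" n] by auto
  then show "dual_power n \<omega> f = 0" using \<omega> by (simp add: mono_poly_def)
qed

lemma polys_lt_Suc:
  assumes "p \<in> polys_lt (Suc n)"
  obtains f u where "f \<in> sym_power s n" "u \<in> polys_lt n" "p = mono_poly s n f + u"
proof -
  obtain f where f: "\<And>k. f k \<in> sym_power s k" "p = (\<Sum>k<Suc n. mono_poly s k (f k))"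
    using polys_lt_expand[OF assms] by metis
  show ?thesis
  proof (rule that)
    show "f n \<in> sym_power s n" by (rule f)
    show "(\<Sum>k<n. mono_poly s k (f k)) \<in> polys_lt n"
      using f(1) by (auto intro!: fs.subspace_sum[OF subspace_polys_lt] mono_poly_in_polys_lt)
    show "p = mono_poly s n (f n) + (\<Sum>k<n. mono_poly s k (f k))"
      by (simp add: f(2) add.commute)
  qed
qed

text \<open>
  For \<open>\<omega> \<mapsto> \<langle>\<omega>, v\<rangle>\<^sup>n\<close> this is the binomial theorem.
\<close>

lemma shift_in_polys:
  assumes "p \<in> polys s" and \<theta>: "\<theta> \<in> dual s"
  shows "shift \<theta> p \<in> polys s"
  using assms(1)
proof (induction rule: polys_induct)
  case zero
  show ?case by (simp add: fs.subspace_0[OF subspace_polys])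
next
  case (step c n v q)
  have "shift \<theta> (mono_poly s n (tpow s n v))
      = (\<Sum>k\<le>n. fscale (of_nat (n choose k) * \<theta> v ^ (n - k)) (mono_poly s k (tpow s k v)))"
    by (auto simp: fun_eq_iff shift_def mono_poly_tpow add_in_dual_iff[OF \<theta>] sum_fun_apply pointwise
      binomial_ring algebra_simps intro!: sum.cong)
  also have "\<dots> \<in> polys s"
    using subspace_polys
    by (intro fs.subspace_sum fs.subspace_scale mono_poly_in_polys tpow_in_sym_power)
  finally show ?case
    using step subspace_polys by (auto simp: shift_add shift_fscale intro: fs.subspace_add fs.subspace_scale)
qed

lemma DERIV_monomial_along:
  assumes \<theta>: "\<theta> \<in> dual s"
  shows "((\<lambda>t. mono_poly s n (tpow s n v) (\<omega> + fscale t \<theta>)) has_field_derivative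
    of_nat n * \<theta> v * mono_poly s (n - 1) (tpow s (n - 1) v) \<omega>) (at 0)"
proof (cases "\<omega> \<in> dual s")
  case True
  have "((\<lambda>t. (\<omega> v + t * \<theta> v) ^ n) has_field_derivative of_nat n * \<theta> v * \<omega> v ^ (n - 1)) (at 0)"
    by (auto intro!: derivative_eq_intros)
  with True show ?thesis
    by (simp add: mono_poly_tpow add_in_dual_iff[OF dual_closed(3)[OF vector_space_axioms \<theta>]] pointwise)
next
  case False
  then show ?thesis
    by (simp add: mono_poly_tpow add_in_dual_iff[OF dual_closed(3)[OF vector_space_axioms \<theta>]])
qed

lemma polys_differentiable:
  assumes "p \<in> polys s" "\<theta> \<in> dual s"
  shows "\<exists>D. ((\<lambda>t. p (\<omega> + fscale t \<theta>)) has_field_derivative D) (at 0)"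
  using assms(1)
proof (induction rule: polys_induct)
  case (step c n v q)
  then obtain D where "((\<lambda>t. q (\<omega> + fscale t \<theta>)) has_field_derivative D) (at 0)" by blast
  from DERIV_add[OF DERIV_cmult[OF DERIV_monomial_along[OF assms(2), of n v \<omega>], of c] this]
  moreover have "(fscale c (mono_poly s n (tpow s n v)) + q) \<eta>
      = c * mono_poly s n (tpow s n v) \<eta> + q \<eta>" for \<eta>
    by (simp add: pointwise)
  ultimately show ?case by (simp only:) blast
qed (auto simp: pointwise intro!: exI[of _ 0])

lemma dir_deriv_monomial:
  assumes "\<theta> \<in> dual s"
  shows "dir_deriv \<theta> (mono_poly s n (tpow s n v))
    = fscale (of_nat n * \<theta> v) (mono_poly s (n - 1) (tpow s (n - 1) v))"
  using DERIV_imp_deriv[OF DERIV_monomial_along[OF assms]]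
  by (simp add: dir_deriv_def fun_eq_iff pointwise)

lemma dir_deriv_linear:
  assumes "\<theta> \<in> dual s" "p \<in> polys s" "q \<in> polys s"
  shows "dir_deriv \<theta> (p + q) = dir_deriv \<theta> p + dir_deriv \<theta> q"
    "dir_deriv \<theta> (fscale c p) = fscale c (dir_deriv \<theta> p)"
proof -
  have "deriv (\<lambda>t. p (\<omega> + fscale t \<theta>) + q (\<omega> + fscale t \<theta>)) 0
      = deriv (\<lambda>t. p (\<omega> + fscale t \<theta>)) 0 + deriv (\<lambda>t. q (\<omega> + fscale t \<theta>)) 0 \<and>
    deriv (\<lambda>t. c * p (\<omega> + fscale t \<theta>)) 0 = c * deriv (\<lambda>t. p (\<omega> + fscale t \<theta>)) 0" for \<omega>
  proof -
    obtain D E where D: "((\<lambda>t. p (\<omega> + fscale t \<theta>)) has_field_derivative D) (at 0)"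
      and E: "((\<lambda>t. q (\<omega> + fscale t \<theta>)) has_field_derivative E) (at 0)"
      using polys_differentiable[OF assms(2,1)] polys_differentiable[OF assms(3,1)] by blast
    show ?thesis
      using DERIV_imp_deriv[OF D] DERIV_imp_deriv[OF E] DERIV_imp_deriv[OF DERIV_add[OF D E]]
        DERIV_imp_deriv[OF DERIV_cmult[OF D, of c]] by simp
  qed
  then show "dir_deriv \<theta> (p + q) = dir_deriv \<theta> p + dir_deriv \<theta> q"
    "dir_deriv \<theta> (fscale c p) = fscale c (dir_deriv \<theta> p)"
    by (simp_all add: dir_deriv_def fun_eq_iff pointwise)
qed

lemma dir_deriv_in_polys:
  assumes "\<theta> \<in> dual s" "p \<in> polys s"
  shows "dir_deriv \<theta> p \<in> polys s"
  using assms(2)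
proof (induction rule: polys_induct)
  case zero
  have "dir_deriv \<theta> 0 = 0" by (simp add: dir_deriv_def fun_eq_iff pointwise)
  then show ?case by (simp add: fs.subspace_0[OF subspace_polys])
next
  case (step c n v q)
  note m = mono_poly_in_polys[OF tpow_in_sym_power]
  show ?case
    using step m subspace_polys assms(1)
    by (simp add: dir_deriv_linear dir_deriv_monomial fs.subspace_scale fs.subspace_add)
qed

end


section \<open>Polynomial sequences and their lowering operators\<close>

interpretation tf: vector_space "vscale (fscale :: 'f::field \<Rightarrow> ('y \<Rightarrow> 'f) \<Rightarrow> 'y \<Rightarrow> 'f)
    :: 'f \<Rightarrow> ('x \<Rightarrow> 'y \<Rightarrow> 'f) \<Rightarrow> 'x \<Rightarrow> 'y \<Rightarrow> 'f"
  by unfold_locales (auto simp: vscale_def fscale_def fun_eq_iff pointwise algebra_simps)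

lemma vscale_apply: "vscale sW c g x = sW c (g x)"
  by (simp add: vscale_def)

context dual_space begin

lemma operator_linear:
  assumes "T \<in> poly_operators s"
  shows "p \<in> polys s \<Longrightarrow> T p \<in> polys s"
    and "p \<in> polys s \<Longrightarrow> q \<in> polys s \<Longrightarrow> T (p + q) = T p + T q"
    and "p \<in> polys s \<Longrightarrow> T (fscale c p) = fscale c (T p)"
    and "T 0 = 0"
  using assms linear_on_zero[of fscale fscale "polys s" "polys s" T] fs.subspace_0[OF subspace_polys]
  by (auto simp: poly_operators_def linear_on_def)

lemma operator_sum:
  assumes "T \<in> poly_operators s" "\<And>i. i \<in> A \<Longrightarrow> p i \<in> polys s"
  shows "T (\<Sum>i\<in>A. p i) = (\<Sum>i\<in>A. T (p i))"
  using assms(1) linear_on_sum[OF _ subspace_polys assms(2)] by (auto simp: poly_operators_def)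

lemma subspace_polys_into: "tf.subspace (polys_into s fscale (sym_power s k))"
  by (simp add: polys_into_def)

lemma polys_into_values:
  assumes "g \<in> polys_into s fscale (sym_power s k)"
  shows "g \<omega> \<in> sym_power s k \<and> (\<omega> \<notin> dual s \<longrightarrow> g \<omega> = 0)"
  using assms unfolding polys_into_def
proof (induction rule: tf.span_induct_alt)
  case base
  have "(0 :: _ \<Rightarrow> ('v, 'f) tensor) \<omega> = 0" by (rule zero_fun_apply)
  then show ?case using fs.subspace_0[OF subspace_sym_power] by simp
next
  case (step c x y)
  then obtain p w where x: "x = (\<lambda>\<omega>. fscale (p \<omega>) w)" "p \<in> polys s" "w \<in> sym_power s k" by blast
  have "(vscale fscale c x + y) \<omega> = fscale (c * p \<omega>) w + y \<omega>"
    by (simp add: x plus_fun_apply vscale_apply)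
  with step x polys_outside_dual[of p \<omega>] show ?case
    using subspace_sym_power by (auto intro: fs.subspace_add fs.subspace_scale)
qed

lemma polys_into_shift:
  assumes "g \<in> polys_into s fscale (sym_power s k)" "\<theta> \<in> dual s"
  shows "(\<lambda>\<omega>. g (\<omega> + \<theta>)) \<in> polys_into s fscale (sym_power s k)"
  using assms(1) unfolding polys_into_def
proof (induction rule: tf.span_induct_alt)
  case base
  have "(\<lambda>\<omega>. (0 :: _ \<Rightarrow> ('v, 'f) tensor) (\<omega> + \<theta>)) = 0" by (simp add: fun_eq_iff pointwise)
  then show ?case by (simp only: tf.span_zero)
next
  case (step c x y)
  then obtain p w where x: "x = (\<lambda>\<omega>. fscale (p \<omega>) w)" "p \<in> polys s" "w \<in> sym_power s k" by blast
  have "(\<lambda>\<omega>. (vscale fscale c x + y) (\<omega> + \<theta>))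
      = vscale fscale c (\<lambda>\<omega>. fscale (shift \<theta> p \<omega>) w) + (\<lambda>\<omega>. y (\<omega> + \<theta>))"
    by (rule ext) (simp add: x plus_fun_apply vscale_apply shift_def)
  moreover have m: "(\<lambda>\<omega>. fscale (shift \<theta> p \<omega>) w) \<in> {(\<lambda>\<omega>. fscale (p \<omega>) w) |p w. p \<in> polys s \<and> w \<in> sym_power s k}"
    using x shift_in_polys[OF _ assms(2)] by blast
  ultimately show ?case
    using tf.span_add[OF tf.span_scale[OF tf.span_base[OF m]] step.IH] by (simp only:)
qed

end

locale poly_sequence = dual_space s
  for s :: "'f::real_normed_field \<Rightarrow> 'v::ab_group_add \<Rightarrow> 'v" +
  fixes P :: "('v, 'f) poly_op"
  assumes P: "P \<in> seq_operators s"
begin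

lemma P_operator: "P \<in> poly_operators s"
  using P by (simp add: seq_operators_def)

lemmas P_linear = operator_linear[OF P_operator]

text \<open>
  The diagonal entries \<open>c n = P\<^sub>n\<^sub>n\<close> of the matrix of \<open>P\<close>: modulo lower degree, \<open>P\<close> acts on
  homogeneous polynomials through them.
\<close>

lemma P_leading_part:
  obtains c where "\<And>n. bij_betw (c n) (sym_power s n) (sym_power s n)"
    and "\<And>n f. f \<in> sym_power s n \<Longrightarrow> c n f = 0 \<Longrightarrow> f = 0"
    and "\<And>n f. f \<in> sym_power s n \<Longrightarrow> P (mono_poly s n f) - mono_poly s n (c n f) \<in> polys_lt n"
proof -
  obtain C where C: "\<And>n k. k \<le> n \<Longrightarrow> linear_on fscale fscale (sym_power s n) (sym_power s k) (C k n)"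
    "\<And>n. bij_betw (C n n) (sym_power s n) (sym_power s n)"
    "\<And>n f. f \<in> sym_power s n \<Longrightarrow> P (mono_poly s n f) = (\<Sum>k\<le>n. mono_poly s k (C k n f))"
    using P unfolding seq_operators_def by blast
  show ?thesis
  proof (rule that[of "\<lambda>n. C n n"])
    fix n f assume f: "f \<in> sym_power s n"
    have "C n n 0 = 0"
      using linear_on_zero[OF C(1)[OF order_refl]] fs.subspace_0[OF subspace_sym_power] by blast
    then show "f = 0" if "C n n f = 0"
      using that f C(2)[of n] fs.subspace_0[OF subspace_sym_power]
      unfolding bij_betw_def inj_on_def by metis
    have "P (mono_poly s n f) - mono_poly s n (C n n f) = (\<Sum>k<n. mono_poly s k (C k n f))"
      using C(3)[OF f] by (simp flip: lessThan_Suc_atMost)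
    also have "\<dots> \<in> polys_lt n"
      using C(1) f by (intro fs.subspace_sum[OF subspace_polys_lt] mono_poly_in_polys_lt)
        (auto simp: linear_on_def)
    finally show "P (mono_poly s n f) - mono_poly s n (C n n f) \<in> polys_lt n" .
  qed (rule C(2))
qed

lemma polys_lt_subset: "polys_lt n \<subseteq> polys s"
  by (auto simp: polys_eq_UN)

lemma P_polys_lt:
  assumes "p \<in> polys_lt n"
  shows "P p \<in> polys_lt n"
  using assms
proof (induction n arbitrary: p)
  case 0
  then have "p = 0" by (simp add: polys_lt_def)
  then show ?case by (simp add: P_linear(4) fs.subspace_0[OF subspace_polys_lt])
next
  case (Suc n)
  obtain f u where fu: "f \<in> sym_power s n" "u \<in> polys_lt n" "p = mono_poly s n f + u"
    using polys_lt_Suc[OF Suc.prems] by metis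
  obtain c where c: "\<And>n. bij_betw (c n) (sym_power s n) (sym_power s n)"
    "\<And>n f. f \<in> sym_power s n \<Longrightarrow> c n f = 0 \<Longrightarrow> f = 0"
    "\<And>n f. f \<in> sym_power s n \<Longrightarrow> P (mono_poly s n f) - mono_poly s n (c n f) \<in> polys_lt n"
    by (rule P_leading_part) blast
  have "c n f \<in> sym_power s n" using bij_betwE[OF c(1)] fu(1) by blast
  then have 1: "mono_poly s n (c n f) \<in> polys_lt (Suc n)" by (rule mono_poly_in_polys_lt) simp
  have sub: "polys_lt n \<subseteq> polys_lt (Suc n)" by (simp add: polys_lt_mono)
  have "P p = mono_poly s n (c n f) + (P (mono_poly s n f) - mono_poly s n (c n f)) + P u"
    using fu polys_lt_subset by (simp add: P_linear(2) mono_poly_in_polys subset_iff)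
  also have "\<dots> \<in> polys_lt (Suc n)"
    using 1 c(3)[OF fu(1)] Suc.IH[OF fu(2)] sub by (intro fs.subspace_add[OF subspace_polys_lt]) auto
  finally show ?case .
qed

text \<open>
  The leading part of \<open>P p\<close> is the image of that of \<open>p\<close> under the bijection \<open>P\<^sub>n\<^sub>n\<close>; if it vanishes,
  \<open>p\<close> has lower degree.
\<close>

lemma P_zero_imp_zero:
  assumes "p \<in> polys_lt n" "P p = 0"
  shows "p = 0"
  using assms
proof (induction n arbitrary: p)
  case 0
  then show ?case by (simp add: polys_lt_def)
next
  case (Suc n)
  obtain f u where fu: "f \<in> sym_power s n" "u \<in> polys_lt n" "p = mono_poly s n f + u"
    using polys_lt_Suc[OF Suc.prems(1)] by metis
  obtain c where c: "\<And>n. bij_betw (c n) (sym_power s n) (sym_power s n)"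
    "\<And>n f. f \<in> sym_power s n \<Longrightarrow> c n f = 0 \<Longrightarrow> f = 0"
    "\<And>n f. f \<in> sym_power s n \<Longrightarrow> P (mono_poly s n f) - mono_poly s n (c n f) \<in> polys_lt n"
    by (rule P_leading_part) blast
  have cf: "c n f \<in> sym_power s n" using bij_betwE[OF c(1)] fu(1) by blast
  have "P (mono_poly s n f) + P u = 0"
    using fu polys_lt_subset Suc.prems(2) by (simp add: P_linear(2) mono_poly_in_polys subset_iff)
  then have "mono_poly s n (c n f) = - (P (mono_poly s n f) - mono_poly s n (c n f)) - P u"
    by (simp add: algebra_simps eq_neg_iff_add_eq_0)
  also have "\<dots> \<in> polys_lt n"
    by (rule fs.subspace_diff[OF subspace_polys_lt
      fs.subspace_neg[OF subspace_polys_lt c(3)[OF fu(1)]] P_polys_lt[OF fu(2)]])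
  finally have "c n f = 0" by (rule homogeneous_in_polys_lt_imp_zero[OF cf])
  then have "p = u" using c(2)[OF fu(1)] fu(3) by simp
  then show ?case using Suc fu(2) by blast
qed

text \<open>
  Match the leading part using surjectivity of \<open>P\<^sub>n\<^sub>n\<close>; the remainder has lower degree.
\<close>

lemma P_onto_polys_lt:
  assumes "p \<in> polys_lt n"
  shows "p \<in> P ` polys s"
  using assms
proof (induction n arbitrary: p)
  case 0
  then have "p = 0" by (simp add: polys_lt_def)
  then show ?case using P_linear(4) fs.subspace_0[OF subspace_polys] by (metis imageI)
next
  case (Suc n)
  obtain g u where gu: "g \<in> sym_power s n" "u \<in> polys_lt n" "p = mono_poly s n g + u"
    using polys_lt_Suc[OF Suc.prems] by metis
  obtain c where c: "\<And>n. bij_betw (c n) (sym_power s n) (sym_power s n)"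
    "\<And>n f. f \<in> sym_power s n \<Longrightarrow> c n f = 0 \<Longrightarrow> f = 0"
    "\<And>n f. f \<in> sym_power s n \<Longrightarrow> P (mono_poly s n f) - mono_poly s n (c n f) \<in> polys_lt n"
    by (rule P_leading_part) blast
  have "g \<in> c n ` sym_power s n" using bij_betw_imp_surj_on[OF c(1)] gu(1) by simp
  then obtain f where f: "f \<in> sym_power s n" "c n f = g" by blast
  have "u - (P (mono_poly s n f) - mono_poly s n (c n f)) \<in> polys_lt n"
    using gu(2) c(3)[OF f(1)] by (rule fs.subspace_diff[OF subspace_polys_lt])
  then obtain q where q: "q \<in> polys s" "P q = u - (P (mono_poly s n f) - mono_poly s n (c n f))"
    using Suc.IH by (metis imageE)
  have "p = P (mono_poly s n f + q)"
    using q f by (simp add: P_linear(2) mono_poly_in_polys gu(3))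
  then show ?case
    using q(1) mono_poly_in_polys[OF f(1)] fs.subspace_add[OF subspace_polys] by blast
qed

lemma P_inj: "inj_on P (polys s)"
proof (rule inj_onI)
  fix p q assume pq: "p \<in> polys s" "q \<in> polys s" "P p = P q"
  have neg: "fscale (- 1) q = - q" by (simp add: fun_eq_iff pointwise)
  have "P (p - q) = P (p + fscale (- 1) q)" by (simp add: neg)
  also have "\<dots> = P p + fscale (- 1) (P q)"
    using pq fs.subspace_scale[OF subspace_polys] by (simp only: P_linear(2,3))
  also have "\<dots> = 0" by (simp add: pq(3) fun_eq_iff pointwise)
  finally have "P (p - q) = 0" .
  moreover obtain n where "p - q \<in> polys_lt n"
    using fs.subspace_diff[OF subspace_polys pq(1,2)] by (auto simp: polys_eq_UN)
  ultimately show "p = q" using P_zero_imp_zero[of "p - q" n] by simp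
qed

lemma P_surj: "p \<in> polys s \<Longrightarrow> \<exists>q\<in>polys s. p = P q"
  using P_onto_polys_lt unfolding polys_eq_UN by blast

text \<open>
  The polynomial \<open>\<omega> \<mapsto> \<langle>P\<^sub>n(\<omega>), v\<^sup>\<otimes>\<^sup>n\<rangle>\<close>.
\<close>

definition seq_poly :: "nat \<Rightarrow> 'v \<Rightarrow> ('v \<Rightarrow> 'f) \<Rightarrow> 'f"
  where "seq_poly n v = P (mono_poly s n (tpow s n v))"

lemma seq_poly_in_polys: "seq_poly n v \<in> polys s"
  by (simp add: seq_poly_def P_linear(1) mono_poly_in_polys tpow_in_sym_power)

text \<open>
  Since \<open>P\<close> is onto, the polynomials \<open>\<langle>P\<^sub>n, v\<^sup>\<otimes>\<^sup>n\<rangle>\<close> span; on them all lowering operators are explicit.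
\<close>

lemma polys_induct_seq [consumes 1, case_names zero step]:
  assumes "p \<in> polys s" and "R 0"
    and "\<And>c n v q. q \<in> polys s \<Longrightarrow> R q \<Longrightarrow> R (fscale c (seq_poly n v) + q)"
  shows "R p"
proof -
  obtain q where q: "q \<in> polys s" "p = P q" using P_surj[OF assms(1)] by blast
  have "R (P q)"
    using q(1)
  proof (induction rule: polys_induct)
    case zero
    show ?case using assms(2) by (simp add: P_linear(4))
  next
    case (step c n v q)
    then show ?case
      using assms(3)[of "P q" c n v] fs.subspace_scale[OF subspace_polys]
      by (simp add: P_linear seq_poly_def mono_poly_in_polys tpow_in_sym_power)
  qed
  then show ?thesis by (simp add: q(2))
qed

lemma lowering_P: "p \<in> polys s \<Longrightarrow> lowering s P \<theta> (P p) = P (dir_deriv \<theta> p)"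
  by (simp add: lowering_def inv_into_f_f[OF P_inj])

lemma lowering_operator:
  assumes \<theta>: "\<theta> \<in> dual s"
  shows "lowering s P \<theta> \<in> poly_operators s"
  unfolding poly_operators_def linear_on_def
proof (intro CollectI conjI ballI allI)
  fix p assume p: "p \<in> polys s"
  then obtain p' where p': "p' \<in> polys s" "p = P p'" using P_surj by blast
  show "lowering s P \<theta> p \<in> polys s"
    using p' \<theta> by (simp add: lowering_P P_linear(1) dir_deriv_in_polys)
  show "lowering s P \<theta> (fscale c p) = fscale c (lowering s P \<theta> p)" for c
    using p' \<theta> fs.subspace_scale[OF subspace_polys]
    by (simp add: lowering_P dir_deriv_in_polys dir_deriv_linear flip: P_linear(3))
  fix q assume "q \<in> polys s"
  then obtain q' where q': "q' \<in> polys s" "q = P q'" using P_surj by blast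
  show "lowering s P \<theta> (p + q) = lowering s P \<theta> p + lowering s P \<theta> q"
    using p' q' \<theta> fs.subspace_add[OF subspace_polys]
    by (simp add: lowering_P dir_deriv_in_polys dir_deriv_linear flip: P_linear(2))
qed

text \<open>
  The image under \<open>P\<close> of the rule \<open>D(\<theta>) \<langle>\<omega>, v\<rangle>\<^sup>n = n \<langle>\<theta>, v\<rangle> \<langle>\<omega>, v\<rangle>\<^sup>n\<^sup>-\<^sup>1\<close>.  For \<open>n = 0\<close> the factor
  \<open>of_nat n\<close> makes the truncated index \<open>n - 1\<close> harmless.
\<close>

lemma lowering_seq_poly:
  assumes "\<theta> \<in> dual s"
  shows "lowering s P \<theta> (seq_poly n v) = fscale (of_nat n * \<theta> v) (seq_poly (n - 1) v)"
  using assms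
  by (simp add: seq_poly_def lowering_P mono_poly_in_polys tpow_in_sym_power dir_deriv_monomial P_linear(3))

lemma foldr_lowering_operator:
  assumes "set \<theta>s \<subseteq> dual s"
  shows "foldr (lowering s P) \<theta>s \<in> poly_operators s"
  using assms
proof (induction \<theta>s)
  case Nil
  then show ?case by (simp add: poly_operators_def linear_on_def)
next
  case (Cons \<theta> \<theta>s)
  then have "lowering s P \<theta> \<in> poly_operators s" "foldr (lowering s P) \<theta>s \<in> poly_operators s"
    using lowering_operator by auto
  then show ?case by (simp add: poly_operators_def linear_on_def)
qed

text \<open>
  The first product is the falling factorial \<open>n (n - 1) \<cdots> (n - k + 1)\<close> with \<open>k = length \<theta>s\<close>; by
  truncated subtraction it contains the factor \<open>0\<close> as soon as \<open>k > n\<close>.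
\<close>

lemma foldr_lowering_seq_poly:
  assumes "set \<theta>s \<subseteq> dual s"
  shows "foldr (lowering s P) \<theta>s (seq_poly n v)
    = fscale ((\<Prod>i<length \<theta>s. of_nat (n - i)) * (\<Prod>\<theta>\<leftarrow>\<theta>s. \<theta> v)) (seq_poly (n - length \<theta>s) v)"
  using assms
proof (induction \<theta>s)
  case (Cons \<theta> \<theta>s)
  then have \<theta>: "\<theta> \<in> dual s" by simp
  show ?case
    using Cons operator_linear(3)[OF lowering_operator[OF \<theta>] seq_poly_in_polys]
    by (simp add: lowering_seq_poly[OF \<theta>] algebra_simps)
qed (simp add: fun_eq_iff pointwise)

text \<open>
  The property by which \<open>lowering_power\<close> selects its value.  It is compatible with linear
  combinations and shifts, so identities for \<open>Q\<^sup>k\<close> follow by exhibiting a candidate.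
\<close>

definition is_lowering_power :: "nat \<Rightarrow> (('v \<Rightarrow> 'f) \<Rightarrow> 'f) \<Rightarrow> (('v \<Rightarrow> 'f) \<Rightarrow> ('v, 'f) tensor) \<Rightarrow> bool"
  where "is_lowering_power k p g \<longleftrightarrow> g \<in> polys_into s fscale (sym_power s k) \<and>
      (\<forall>\<theta>s. set \<theta>s \<subseteq> dual s \<and> length \<theta>s = k \<longrightarrow>
        (\<forall>\<omega>\<in>dual s. dual_pair \<theta>s (g \<omega>) = foldr (lowering s P) \<theta>s p \<omega>))"

lemma is_lowering_power_unique:
  assumes g: "is_lowering_power k p g" and h: "is_lowering_power k p h"
  shows "g = h"
proof
  fix \<omega>
  have v: "g \<omega> \<in> sym_power s k" "h \<omega> \<in> sym_power s k" "\<omega> \<notin> dual s \<Longrightarrow> g \<omega> = h \<omega>"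
    using polys_into_values g h unfolding is_lowering_power_def by metis+
  show "g \<omega> = h \<omega>"
  proof (cases "\<omega> \<in> dual s")
    case True
    have "g \<omega> - h \<omega> = 0"
    proof (rule dual_pair_separates)
      show "g \<omega> - h \<omega> \<in> sym_power s k" using v by (intro fs.subspace_diff[OF subspace_sym_power])
      show "dual_pair \<theta>s (g \<omega> - h \<omega>) = 0" if "set \<theta>s \<subseteq> dual s" "length \<theta>s = k" for \<theta>s
        using g h that True by (simp add: is_lowering_power_def dual_pair_diff)
    qed
    then show ?thesis by simp
  qed (rule v(3))
qed

lemma lowering_power_eqI: "is_lowering_power k p g \<Longrightarrow> lowering_power s P k p = g"
  unfolding lowering_power_def is_lowering_power_def[symmetric]
  using is_lowering_power_unique by blast

lemma is_lowering_power_seq_poly: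
  "is_lowering_power k (seq_poly n v)
    (\<lambda>\<omega>. fscale ((\<Prod>i<k. of_nat (n - i)) * seq_poly (n - k) v \<omega>) (tpow s k v))"
proof -
  have "(\<lambda>\<omega>. fscale (fscale (\<Prod>i<k. of_nat (n - i)) (seq_poly (n - k) v) \<omega>) (tpow s k v))
    \<in> {\<lambda>\<omega>. fscale (p \<omega>) w |p w. p \<in> polys s \<and> w \<in> sym_power s k}"
    using seq_poly_in_polys fs.subspace_scale[OF subspace_polys] tpow_in_sym_power by blast
  then show ?thesis
    unfolding is_lowering_power_def polys_into_def
    by (auto simp: fscale_apply foldr_lowering_seq_poly dual_pair_tpow intro: tf.span_base)
qed

lemma is_lowering_power_lincomb:
  assumes "is_lowering_power k p g" "is_lowering_power k q h" "p \<in> polys s" "q \<in> polys s"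
  shows "is_lowering_power k (fscale c p + q) (vscale fscale c g + h)"
  unfolding is_lowering_power_def
proof (intro conjI allI impI ballI)
  show "vscale fscale c g + h \<in> polys_into s fscale (sym_power s k)"
    using assms(1,2) unfolding is_lowering_power_def
    by (intro tf.subspace_add[OF subspace_polys_into] tf.subspace_scale[OF subspace_polys_into]) auto
  fix \<theta>s \<omega> assume \<theta>s: "set \<theta>s \<subseteq> dual s \<and> length \<theta>s = k" and \<omega>: "\<omega> \<in> dual s"
  have "foldr (lowering s P) \<theta>s (fscale c p + q)
      = fscale c (foldr (lowering s P) \<theta>s p) + foldr (lowering s P) \<theta>s q"
    using operator_linear[OF foldr_lowering_operator, of \<theta>s] \<theta>s assms(3,4)
      fs.subspace_scale[OF subspace_polys] by simp
  then show "dual_pair \<theta>s ((vscale fscale c g + h) \<omega>) = foldr (lowering s P) \<theta>s (fscale c p + q) \<omega>"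
    using assms(1,2) \<theta>s \<omega> by (simp add: is_lowering_power_def vscale_apply pointwise dual_pair_linear)
qed

lemma is_lowering_power_zero: "is_lowering_power k 0 0"
proof -
  have "foldr (lowering s P) \<theta>s 0 = 0" if "set \<theta>s \<subseteq> dual s" for \<theta>s
    by (rule operator_linear(4)[OF foldr_lowering_operator[OF that]])
  then show ?thesis
    using tf.subspace_0[OF subspace_polys_into] by (simp add: is_lowering_power_def pointwise)
qed

text \<open>
  Existence of \<open>Q\<^sup>k p\<close>: it is explicit on a spanning set and passes to linear combinations.
\<close>

lemma is_lowering_power_lowering_power:
  assumes "p \<in> polys s"
  shows "is_lowering_power k p (lowering_power s P k p)"
proof -
  have "\<exists>g. is_lowering_power k p g"
    using assms
  proof (induction rule: polys_induct_seq)
    case zero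
    show ?case using is_lowering_power_zero by blast
  next
    case (step c n v q)
    then show ?case
      using is_lowering_power_lincomb[OF is_lowering_power_seq_poly _ seq_poly_in_polys] by blast
  qed
  then show ?thesis using lowering_power_eqI by metis
qed

lemma lowering_power_seq_poly:
  "lowering_power s P k (seq_poly n v)
    = (\<lambda>\<omega>. fscale ((\<Prod>i<k. of_nat (n - i)) * seq_poly (n - k) v \<omega>) (tpow s k v))"
  by (rule lowering_power_eqI[OF is_lowering_power_seq_poly])

lemma lowering_power_lincomb:
  assumes "p \<in> polys s" "q \<in> polys s"
  shows "lowering_power s P k (fscale c p + q)
    = vscale fscale c (lowering_power s P k p) + lowering_power s P k q"
  by (intro lowering_power_eqI is_lowering_power_lincomb is_lowering_power_lowering_power assms)

lemma lowering_power_zero: "lowering_power s P k 0 = 0"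
  by (rule lowering_power_eqI[OF is_lowering_power_zero])

lemma lowering_power_in_sym_power: "p \<in> polys s \<Longrightarrow> lowering_power s P k p \<omega> \<in> sym_power s k"
  using is_lowering_power_lowering_power polys_into_values by (metis is_lowering_power_def)

lemma lowering_power_outside_dual:
  "p \<in> polys s \<Longrightarrow> \<omega> \<notin> dual s \<Longrightarrow> lowering_power s P k p \<omega> = 0"
  using is_lowering_power_lowering_power polys_into_values by (metis is_lowering_power_def)

end


lemma sym_dual_fscale:
  assumes "\<phi> \<in> sym_dual s n" "f \<in> sym_power s n"
  shows "\<phi> (fscale c f) = c * \<phi> f"
  using assms by (auto simp: sym_dual_def linear_on_def)

lemma zero_tensor_valued_apply: "(0 :: 'x \<Rightarrow> 'y \<Rightarrow> 'f::zero) x = 0"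
  by (rule zero_fun_apply)

lemma falling_factorial_self: "(\<Prod>i<n. of_nat (n - i)) = (fact n :: 'a::{semiring_char_0, comm_semiring_1})"
  using prod.nat_diff_reindex[of "\<lambda>i. of_nat (Suc i) :: 'a" n]
  by (simp add: fact_prod_Suc atLeast0LessThan Suc_diff_Suc)

context poly_sequence begin

lemma P_mono_poly_lincomb:
  assumes "f \<in> sym_power s k" "g \<in> sym_power s k"
  shows "P (mono_poly s k (fscale c f + g)) = fscale c (P (mono_poly s k f)) + P (mono_poly s k g)"
  using assms mono_poly_in_polys fs.subspace_scale[OF subspace_polys]
  by (simp add: mono_poly_add mono_poly_fscale P_linear)

lemma lowering_power_0:
  assumes "p \<in> polys s"
  shows "lowering_power s P 0 p = (\<lambda>\<omega>. fscale (p \<omega>) (tensor s []))"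
proof (rule lowering_power_eqI)
  have t: "tensor s [] = tpow s 0 0" by (simp add: tpow_def)
  have "(\<lambda>\<omega>. fscale (p \<omega>) (tensor s [])) \<in> {\<lambda>\<omega>. fscale (p \<omega>) w |p w. p \<in> polys s \<and> w \<in> sym_power s 0}"
    using assms tpow_in_sym_power[of 0 0] unfolding t by blast
  then show "is_lowering_power 0 p (\<lambda>\<omega>. fscale (p \<omega>) (tensor s []))"
    unfolding is_lowering_power_def polys_into_def
    by (auto simp: t dual_pair_tpow intro: tf.span_base)
qed

lemma lowering_power_eventually_zero:
  assumes "p \<in> polys s"
  shows "\<exists>N. \<forall>k>N. lowering_power s P k p = 0"
  using assms
proof (induction rule: polys_induct_seq)
  case zero
  show ?case by (simp add: lowering_power_zero)
next
  case (step c n v q)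
  then obtain N where N: "\<forall>k>N. lowering_power s P k q = 0" by blast
  have "lowering_power s P k (seq_poly n v) = 0" if "k > n" for k
  proof -
    have "(\<Prod>i<k. of_nat (n - i) :: 'f) = 0" using that by (intro prod_zero) auto
    then show ?thesis by (simp add: lowering_power_seq_poly fun_eq_iff pointwise)
  qed
  then have "\<forall>k>max n N. lowering_power s P k (fscale c (seq_poly n v) + q) = 0"
    using N step.hyps by (simp add: lowering_power_lincomb seq_poly_in_polys)
  then show ?case ..
qed

text \<open>
  A polynomial is annihilated by all but finitely many \<open>Q\<^sup>k\<close>, so the sum over the nonzero terms can be
  replaced by a sum up to any sufficiently large \<open>N\<close>.
\<close>

lemma lowering_expansion_iff:
  assumes Tk: "\<And>k. k \<ge> 1 \<Longrightarrow> Tk k \<in> sym_dual s k"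
  shows "lowering_expansion s P T T0 Tk \<longleftrightarrow>
    (\<forall>p\<in>polys s. \<forall>N. (\<forall>k>N. lowering_power s P k p = 0) \<longrightarrow>
      T p = fscale T0 p + (\<Sum>k=1..N. pair_lowering_power s P k (Tk k) p))"
proof -
  let ?q = "\<lambda>k p. pair_lowering_power s P k (Tk k) p"
  have Tk0: "Tk k 0 = 0" if "k \<ge> 1" for k
    using linear_on_zero[of fscale "(*)" _ UNIV "Tk k"] Tk[OF that] fs.subspace_0[OF subspace_sym_power]
    by (auto simp: sym_dual_def)
  have sub: "{k. k \<ge> 1 \<and> ?q k p \<noteq> 0} \<subseteq> {1..N}" if N: "\<forall>k>N. lowering_power s P k p = 0" for p N
  proof
    fix k assume k: "k \<in> {k. k \<ge> 1 \<and> ?q k p \<noteq> 0}"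
    have "?q k p = 0" if "lowering_power s P k p = 0"
    proof
      fix \<omega>
      show "?q k p \<omega> = 0 \<omega>"
        using Tk0[of k] k by (simp add: pair_lowering_power_def that zero_tensor_valued_apply) (simp add: zero_fun_apply)
    qed
    then have "lowering_power s P k p \<noteq> 0" using k by blast
    with N k show "k \<in> {1..N}" by (auto simp: not_less)
  qed
  have sum_eq: "(\<Sum>k | k \<ge> 1 \<and> ?q k p \<noteq> 0. ?q k p) = (\<Sum>k=1..N. ?q k p)"
    if "\<forall>k>N. lowering_power s P k p = 0" for p N
    using sub[OF that] by (intro sum.mono_neutral_left) auto
  show ?thesis
    unfolding lowering_expansion_def
  proof (intro ball_cong refl iffI conjI)
    fix p assume "p \<in> polys s"
    then obtain N where N: "\<forall>k>N. lowering_power s P k p = 0"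
      using lowering_power_eventually_zero by blast
    show "finite {k. k \<ge> 1 \<and> ?q k p \<noteq> 0}" by (rule finite_subset[OF sub[OF N]]) simp
    show "T p = fscale T0 p + (\<Sum>k | k \<ge> 1 \<and> ?q k p \<noteq> 0. ?q k p)"
      if "\<forall>N. (\<forall>k>N. lowering_power s P k p = 0) \<longrightarrow> T p = fscale T0 p + (\<Sum>k=1..N. ?q k p)"
      using that N by (simp only: sum_eq[OF N])
  next
    fix p
    assume H: "finite {k. k \<ge> 1 \<and> ?q k p \<noteq> 0} \<and>
      T p = fscale T0 p + (\<Sum>k | k \<ge> 1 \<and> ?q k p \<noteq> 0. ?q k p)"
    show "\<forall>N. (\<forall>k>N. lowering_power s P k p = 0) \<longrightarrow> T p = fscale T0 p + (\<Sum>k=1..N. ?q k p)"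
    proof (intro allI impI)
      fix N assume N: "\<forall>k>N. lowering_power s P k p = 0"
      show "T p = fscale T0 p + (\<Sum>k=1..N. ?q k p)"
        using H unfolding sum_eq[OF N] by (rule conjunct2)
    qed
  qed
qed

end


section \<open>Taylor expansion in powers of the lowering operators\<close>

text \<open>
  In the one-dimensional case these are the basic sequences of delta operators, that is, the
  sequences of binomial type.
\<close>

locale basic_sequence = poly_sequence s P
  for s :: "'f::real_normed_field \<Rightarrow> 'v::ab_group_add \<Rightarrow> 'v" and P :: "('v, 'f) poly_op" +
  assumes P_0: "\<forall>\<omega>\<in>dual s. poly_seq s P 0 \<omega> (tensor s []) = 1"
    and P_at_0: "\<forall>n\<ge>1. \<forall>f\<in>sym_power s n. poly_seq s P n 0 f = 0"
    and Q: "\<forall>\<theta>\<in>dual s. shift_invariant s (lowering s P \<theta>)"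
begin

lemma P_one: "P (mono_poly s 0 (tensor s [])) = const_poly s 1"
proof
  fix \<omega>
  have "P (mono_poly s 0 (tensor s [])) \<in> polys s"
    using seq_poly_in_polys[of 0 0] by (simp add: seq_poly_def tpow_def)
  then show "P (mono_poly s 0 (tensor s [])) \<omega> = const_poly s 1 \<omega>"
    using P_0 polys_outside_dual by (auto simp: poly_seq_def const_poly_def)
qed

lemma seq_poly_0: "seq_poly 0 v = const_poly s 1"
  by (simp add: seq_poly_def tpow_def P_one)

lemma seq_poly_at_0: "seq_poly n v 0 = (if n = 0 then 1 else 0)"
proof (cases "n = 0")
  case True
  then show ?thesis using dual_closed(1)[OF vector_space_axioms] by (simp add: seq_poly_0 const_poly_def)
next
  case False
  then show ?thesis using P_at_0 tpow_in_sym_power by (simp add: seq_poly_def poly_seq_def)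
qed

text \<open>
  For \<open>k < n\<close> the factor \<open>P\<^bsub>n-k\<^esub>(0)\<close> vanishes, for \<open>k > n\<close> the falling factorial does.
\<close>

lemma lowering_power_seq_poly_at_0:
  "lowering_power s P k (seq_poly n v) 0 = (if k = n then fscale (fact n) (tpow s n v) else 0)"
proof -
  consider "k = n" | "k < n" | "n < k" by linarith
  then show ?thesis
  proof cases
    case 3
    then have "(\<Prod>i<k. of_nat (n - i) :: 'f) = 0" by (intro prod_zero) auto
    with 3 show ?thesis by (simp add: lowering_power_seq_poly)
  qed (simp_all add: lowering_power_seq_poly seq_poly_at_0 falling_factorial_self del: of_nat_diff)
qed

lemma lowering_power_P_mono_poly_at_0:
  assumes "f \<in> sym_power s n"
  shows "lowering_power s P k (P (mono_poly s n f)) 0 = (if k = n then fscale (fact n) f else 0)"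
proof -
  have "f \<in> sym_power s n \<and> ?thesis"
    using assms unfolding sym_power_eq_span_powers
  proof (induction rule: fs.span_induct_alt)
    case base
    show ?case by (simp add: zero_tensor_valued_apply P_linear(4) lowering_power_zero fs.span_zero)
  next
    case (step c x y)
    then obtain v where x: "x = tpow s n v" by blast
    have y: "y \<in> sym_power s n" using step.IH by (simp add: sym_power_eq_span_powers)
    have "lowering_power s P k (P (mono_poly s n (fscale c x + y)))
      = vscale fscale c (lowering_power s P k (seq_poly n v)) + lowering_power s P k (P (mono_poly s n y))"
      using y by (simp add: x P_mono_poly_lincomb tpow_in_sym_power lowering_power_lincomb
        seq_poly_in_polys P_linear(1) mono_poly_in_polys flip: seq_poly_def)
    then have "lowering_power s P k (P (mono_poly s n (fscale c x + y))) 0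
      = fscale c (lowering_power s P k (seq_poly n v) 0) + lowering_power s P k (P (mono_poly s n y)) 0"
      by (simp only: plus_fun_apply vscale_apply)
    moreover have "fscale c x + y \<in> fs.span (range (tpow s n))"
      using step x by (intro fs.span_add fs.span_scale) (auto intro: fs.span_base)
    ultimately show ?case
      using step.IH by (simp add: lowering_power_seq_poly_at_0 x fs.scale_right_distrib mult.commute)
  qed
  then show ?thesis ..
qed

text \<open>
  The Taylor formula at the origin.  On \<open>\<langle>P\<^sub>n, v\<^sup>\<otimes>\<^sup>n\<rangle>\<close> only the term \<open>k = n\<close> survives.  The bound on
  the summation is left free above some \<open>N\<close> so that two expansions can be added.
\<close>

lemma expansion_at_0:
  assumes "p \<in> polys s"
  shows "\<exists>N. \<forall>M\<ge>N. p = (\<Sum>k\<le>M. fscale (1 / fact k) (P (mono_poly s k (lowering_power s P k p 0))))"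
  using assms
proof (induction rule: polys_induct_seq)
  case zero
  show ?case by (simp add: zero_tensor_valued_apply lowering_power_zero P_linear(4))
next
  case (step c n v q)
  let ?F = "\<lambda>p k. fscale (1 / fact k) (P (mono_poly s k (lowering_power s P k p 0)))"
  obtain N where N: "\<And>M. M \<ge> N \<Longrightarrow> q = (\<Sum>k\<le>M. ?F q k)" using step.IH by blast
  have "fscale c (seq_poly n v) + q = (\<Sum>k\<le>M. ?F (fscale c (seq_poly n v) + q) k)" if M: "M \<ge> max n N" for M
  proof -
    have F: "?F (fscale c (seq_poly n v) + q) k = fscale c (?F (seq_poly n v) k) + ?F q k" for k
    proof -
      have "lowering_power s P k (fscale c (seq_poly n v) + q) 0
        = fscale c (lowering_power s P k (seq_poly n v) 0) + lowering_power s P k q 0"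
        using step.hyps by (simp only: lowering_power_lincomb seq_poly_in_polys plus_fun_apply vscale_apply)
      then show ?thesis
        using step.hyps lowering_power_in_sym_power seq_poly_in_polys
        by (simp add: P_mono_poly_lincomb fs.scale_right_distrib mult.commute)
    qed
    have "(\<Sum>k\<le>M. ?F (seq_poly n v) k) = (\<Sum>k\<le>M. if k = n then seq_poly n v else 0)"
      by (intro sum.cong refl)
        (simp add: lowering_power_seq_poly_at_0 mono_poly_fscale P_linear(3,4) mono_poly_in_polys
          tpow_in_sym_power flip: seq_poly_def)
    also have "\<dots> = seq_poly n v" using M by simp
    finally show ?thesis
      using N[of M] M by (simp only: F sum.distrib flip: fs.scale_sum_right)
  qed
  then show ?case by blast
qed

text \<open>
  The shifted function \<open>\<omega> \<mapsto> (Q\<^sup>k p)(\<omega> + \<eta>)\<close> satisfies the characterization of \<open>Q\<^sup>k\<close> at \<open>shift \<eta> p\<close>,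
  because each \<open>Q(\<theta>)\<close> commutes with shifts.
\<close>

lemma lowering_power_shift:
  assumes p: "p \<in> polys s" and \<eta>: "\<eta> \<in> dual s"
  shows "lowering_power s P k (shift \<eta> p) = (\<lambda>\<omega>. lowering_power s P k p (\<omega> + \<eta>))"
proof (rule lowering_power_eqI)
  have comm: "foldr (lowering s P) \<theta>s (shift \<eta> p) = shift \<eta> (foldr (lowering s P) \<theta>s p)"
    if "set \<theta>s \<subseteq> dual s" for \<theta>s
    using that
  proof (induction \<theta>s)
    case (Cons \<theta> \<theta>s)
    then have "foldr (lowering s P) \<theta>s p \<in> polys s"
      using operator_linear(1)[OF foldr_lowering_operator p] by simp
    with Cons Q \<eta> show ?case by (simp add: shift_invariant_def)
  qed simp
  then have comm': "foldr (lowering s P) \<theta>s (shift \<eta> p) \<omega> = foldr (lowering s P) \<theta>s p (\<omega> + \<eta>)"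
    if "set \<theta>s \<subseteq> dual s" for \<theta>s \<omega>
    unfolding comm[OF that] by (simp only: shift_def)
  show "is_lowering_power k (shift \<eta> p) (\<lambda>\<omega>. lowering_power s P k p (\<omega> + \<eta>))"
    using is_lowering_power_lowering_power[OF p, of k] polys_into_shift[OF _ \<eta>]
    by (auto simp: is_lowering_power_def comm' add_in_dual_iff[OF \<eta>])
qed

text \<open>
  The formula at the origin for the polynomial \<open>shift \<omega> p\<close>.  Its number of terms depends on \<open>\<omega>\<close> a
  priori; since \<open>Q\<^sup>k p\<close> vanishes identically for \<open>k > N\<close>, the bound \<open>N\<close> serves for all \<open>\<omega>\<close>.
\<close>

lemma taylor_expansion:
  assumes p: "p \<in> polys s" and \<omega>: "\<omega> \<in> dual s" and N: "\<forall>k>N. lowering_power s P k p = 0"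
  shows "shift \<omega> p = (\<Sum>k\<le>N. fscale (1 / fact k) (P (mono_poly s k (lowering_power s P k p \<omega>))))"
proof -
  have lp: "lowering_power s P k (shift \<omega> p) 0 = lowering_power s P k p \<omega>" for k
    by (simp add: lowering_power_shift[OF p \<omega>])
  obtain N' where N': "\<And>M. M \<ge> N' \<Longrightarrow> shift \<omega> p
      = (\<Sum>k\<le>M. fscale (1 / fact k) (P (mono_poly s k (lowering_power s P k p \<omega>))))"
    using expansion_at_0[OF shift_in_polys[OF p \<omega>]] unfolding lp by blast
  \<comment> \<open>The expansion of the shifted polynomial holds from \<open>N'\<close> on, but the terms beyond \<open>N\<close> are zero.\<close>
  have "lowering_power s P k p \<omega> = 0" if "k > N" for k
    using N that by (metis zero_fun_apply)
  then have "(\<Sum>k\<le>max N N'. fscale (1 / fact k) (P (mono_poly s k (lowering_power s P k p \<omega>))))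
    = (\<Sum>k\<le>N. fscale (1 / fact k) (P (mono_poly s k (lowering_power s P k p \<omega>))))"
    by (intro sum.mono_neutral_right) (auto simp: P_linear(4))
  then show ?thesis using N'[of "max N N'"] by simp
qed


section \<open>Expansions of shift-invariant operators\<close>

text \<open>
  Apply \<open>T\<close> to the Taylor expansion of \<open>shift \<omega> p\<close> and evaluate at \<open>0\<close>.  The term \<open>k = 0\<close> is
  \<open>p(\<omega>) (T 1)(0)\<close>, as \<open>Q\<^sup>0 p = p\<close> under the identification of \<open>V\<^sup>\<odot>\<^sup>0\<close> with the scalars.
\<close>

lemma shift_invariant_imp_expansion:
  assumes T: "T \<in> poly_operators s" and inv: "shift_invariant s T"
  defines "Tk \<equiv> \<lambda>k f. 1 / fact k * T (P (mono_poly s k f)) 0"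
  shows "\<forall>k\<ge>1. Tk k \<in> sym_dual s k"
    and "lowering_expansion s P T (T (const_poly s 1) 0) Tk"
proof -
  have Pm: "P (mono_poly s k f) \<in> polys s" if "f \<in> sym_power s k" for k f
    using that by (simp add: P_linear(1) mono_poly_in_polys)
  have Tk: "Tk k \<in> sym_dual s k" for k
    unfolding sym_dual_def linear_on_def Tk_def
    by (auto simp: mono_poly_add mono_poly_fscale P_linear mono_poly_in_polys operator_linear[OF T] Pm
      pointwise algebra_simps add_divide_distrib)
  then show "\<forall>k\<ge>1. Tk k \<in> sym_dual s k" by blast
  show "lowering_expansion s P T (T (const_poly s 1) 0) Tk"
    unfolding lowering_expansion_iff[OF Tk]
  proof (intro ballI allI impI ext)
    fix p N \<omega>
    assume p: "p \<in> polys s" and N: "\<forall>k>N. lowering_power s P k p = 0"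
    let ?lp = "\<lambda>k. lowering_power s P k p \<omega>"
    show "T p \<omega> = (fscale (T (const_poly s 1) 0) p + (\<Sum>k=1..N. pair_lowering_power s P k (Tk k) p)) \<omega>"
    proof (cases "\<omega> \<in> dual s")
      case True
      have "T p \<omega> = shift \<omega> (T p) 0" by (simp add: shift_def)
      also have "\<dots> = T (shift \<omega> p) 0" using inv p True by (simp add: shift_invariant_def)
      also have "\<dots> = (\<Sum>k\<le>N. Tk k (?lp k))"
        using lowering_power_in_sym_power[OF p] Pm fs.subspace_scale[OF subspace_polys]
        by (simp add: taylor_expansion[OF p True N] operator_sum[OF T] operator_linear(3)[OF T]
          sum_fun_apply fscale_apply Tk_def)
      also have "\<dots> = Tk 0 (?lp 0) + (\<Sum>k=1..N. Tk k (?lp k))"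
      proof -
        have "{..N} = insert 0 {1..N}" by auto
        then show ?thesis by simp
      qed
      also have "Tk 0 (?lp 0) = p \<omega> * T (const_poly s 1) 0"
      proof -
        have c: "const_poly s 1 \<in> polys s" using seq_poly_in_polys[of 0 0] by (simp add: seq_poly_0)
        have t: "tensor s [] \<in> sym_power s 0" using tpow_in_sym_power[of 0 0] by (simp add: tpow_def)
        have "P (mono_poly s 0 (?lp 0)) = fscale (p \<omega>) (const_poly s 1)"
          by (simp add: lowering_power_0[OF p] mono_poly_fscale P_linear(3) mono_poly_in_polys[OF t] P_one)
        then show ?thesis by (simp add: Tk_def operator_linear(3)[OF T c] fscale_apply)
      qed
      finally show ?thesis
        by (simp add: pointwise sum_fun_apply pair_lowering_power_def)
    next
      case False
      have "Tk k 0 = 0" for k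
        by (simp add: Tk_def P_linear(4) operator_linear(4)[OF T] pointwise)
      then show ?thesis
        using False p operator_linear(1)[OF T p]
        by (simp add: pointwise sum_fun_apply pair_lowering_power_def polys_outside_dual
          lowering_power_outside_dual)
    qed
  qed
qed

lemma expansion_imp_shift_invariant:
  assumes Tk: "\<And>k. k \<ge> 1 \<Longrightarrow> Tk k \<in> sym_dual s k" and e: "lowering_expansion s P T T0 Tk"
  shows "shift_invariant s T"
  unfolding shift_invariant_def
proof (intro ballI)
  fix \<theta> p assume \<theta>: "\<theta> \<in> dual s" and p: "p \<in> polys s"
  have e: "T q = fscale T0 q + (\<Sum>k=1..N. pair_lowering_power s P k (Tk k) q)"
    if "q \<in> polys s" "\<And>k. k > N \<Longrightarrow> lowering_power s P k q = 0" for q N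
    using e that lowering_expansion_iff[OF Tk] by blast
  obtain N where N: "\<And>k. k > N \<Longrightarrow> lowering_power s P k p = 0"
    using lowering_power_eventually_zero[OF p] by blast
  have "lowering_power s P k (shift \<theta> p) = 0" if "k > N" for k
    by (simp add: lowering_power_shift[OF p \<theta>] N[OF that] fun_eq_iff zero_fun_apply)
  then have "T (shift \<theta> p)
      = fscale T0 (shift \<theta> p) + (\<Sum>k=1..N. pair_lowering_power s P k (Tk k) (shift \<theta> p))"
    by (rule e[OF shift_in_polys[OF p \<theta>]])
  also have "\<dots> = shift \<theta> (fscale T0 p + (\<Sum>k=1..N. pair_lowering_power s P k (Tk k) p))"
    by (simp add: shift_add shift_fscale shift_sum pair_lowering_power_def lowering_power_shift[OF p \<theta>]
      shift_def[of _ "\<lambda>\<omega>. Tk _ (_ \<omega>)"])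
  also have "\<dots> = shift \<theta> (T p)" by (simp add: e[OF p N])
  finally show "T (shift \<theta> p) = shift \<theta> (T p)" .
qed

text \<open>
  On the constant \<open>1\<close> all terms with \<open>k \<ge> 1\<close> vanish.  On \<open>\<langle>P\<^sub>k, f\<rangle>\<close>, evaluation at \<open>0\<close> removes the
  \<open>T\<^sub>0\<close> term, since \<open>P\<^sub>k(0) = 0\<close>, and all terms of index other than \<open>k\<close>.
\<close>

lemma expansion_coefficients:
  assumes Tk: "\<And>k. k \<ge> 1 \<Longrightarrow> Tk k \<in> sym_dual s k" and e: "lowering_expansion s P T T0 Tk"
  shows "T (const_poly s 1) = const_poly s T0"
    and "k \<ge> 1 \<Longrightarrow> f \<in> sym_power s k \<Longrightarrow> Tk k f = 1 / fact k * T (P (mono_poly s k f)) 0"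
proof -
  have e: "T q = fscale T0 q + (\<Sum>k=1..N. pair_lowering_power s P k (Tk k) q)"
    if "q \<in> polys s" "\<And>k. k > N \<Longrightarrow> lowering_power s P k q = 0" for q N
    using e that lowering_expansion_iff[OF Tk] by blast
  have "lowering_power s P k (seq_poly 0 0) = 0" if "k > 0" for k
  proof -
    have "(\<Prod>i<k. of_nat (0 - i) :: 'f) = 0" using that by (intro prod_zero) auto
    then show ?thesis by (simp add: lowering_power_seq_poly fun_eq_iff pointwise)
  qed
  then have "T (const_poly s 1) = fscale T0 (const_poly s 1)"
    using e[OF seq_poly_in_polys, of 0 0 0] by (simp add: seq_poly_0)
  also have "\<dots> = const_poly s T0" by (simp add: const_poly_def fun_eq_iff fscale_apply)
  finally show "T (const_poly s 1) = const_poly s T0" .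
  assume k: "k \<ge> 1" and f: "f \<in> sym_power s k"
  let ?p = "P (mono_poly s k f)"
  have p: "?p \<in> polys s" using f by (simp add: P_linear(1) mono_poly_in_polys)
  have Tk0: "Tk j 0 = 0" if "j \<ge> 1" for j
    using sym_dual_fscale[OF Tk[OF that], of 0 0] fs.subspace_0[OF subspace_sym_power] by simp
  obtain N where "\<And>j. j > N \<Longrightarrow> lowering_power s P j ?p = 0"
    using lowering_power_eventually_zero[OF p] by blast
  then have "T ?p = fscale T0 ?p + (\<Sum>j=1..max N k. pair_lowering_power s P j (Tk j) ?p)"
    by (intro e[OF p]) simp
  then have "T ?p 0 = T0 * ?p 0 + (\<Sum>j=1..max N k. Tk j (lowering_power s P j ?p 0))"
    by (simp add: pointwise sum_fun_apply pair_lowering_power_def)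
  also have "?p 0 = 0" using P_at_0 k f by (simp add: poly_seq_def)
  also have "(\<Sum>j=1..max N k. Tk j (lowering_power s P j ?p 0))
      = (\<Sum>j=1..max N k. if j = k then fact k * Tk k f else 0)"
    using k f by (intro sum.cong refl)
      (auto simp: lowering_power_P_mono_poly_at_0 Tk0 sym_dual_fscale[OF Tk])
  also have "\<dots> = fact k * Tk k f" using k by simp
  finally show "Tk k f = 1 / fact k * T ?p 0" by simp
qed

end

theorem theorem3p9:
  fixes s :: "'f::real_normed_field \<Rightarrow> 'v::ab_group_add \<Rightarrow> 'v"
    and P T :: "('v, 'f) poly_op"
  assumes V: "vector_space s"
    and P: "P \<in> seq_operators s"
    and P_0: "\<forall>\<omega>\<in>dual s. poly_seq s P 0 \<omega> (tensor s []) = 1"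
    and P_at_0: "\<forall>n\<ge>1. \<forall>f\<in>sym_power s n. poly_seq s P n 0 f = 0"
    and Q: "\<forall>\<theta>\<in>dual s. shift_invariant s (lowering s P \<theta>)"
    and T: "T \<in> poly_operators s"
  shows
    "(shift_invariant s T \<longleftrightarrow>
        (\<exists>T0 Tk. (\<forall>k\<ge>1. Tk k \<in> sym_dual s k) \<and> lowering_expansion s P T T0 Tk)) \<and>
     (\<forall>T0 Tk. (\<forall>k\<ge>1. Tk k \<in> sym_dual s k) \<and> lowering_expansion s P T T0 Tk \<longrightarrow>
        T (const_poly s 1) = const_poly s T0 \<and>
        (\<forall>k\<ge>1. \<forall>f\<in>sym_power s k.
           Tk k f = 1 / fact k * T (\<lambda>\<omega>. poly_seq s P k \<omega> f) 0))"
proof -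
  interpret vector_space s by (rule V)
  interpret basic_sequence s P
    by unfold_locales (fact P P_0 P_at_0 Q)+
  have eta: "(\<lambda>\<omega>. poly_seq s P k \<omega> f) = P (mono_poly s k f)" for k f
    by (simp add: poly_seq_def)
  show ?thesis
  proof (intro conjI allI impI iffI)
    assume "shift_invariant s T"
    from shift_invariant_imp_expansion[OF T this]
    show "\<exists>T0 Tk. (\<forall>k\<ge>1. Tk k \<in> sym_dual s k) \<and> lowering_expansion s P T T0 Tk"
      by (intro exI[of _ "T (const_poly s 1) 0"]
        exI[of _ "\<lambda>k f. 1 / fact k * T (P (mono_poly s k f)) 0"] conjI)
  next
    assume "\<exists>T0 Tk. (\<forall>k\<ge>1. Tk k \<in> sym_dual s k) \<and> lowering_expansion s P T T0 Tk"
    then show "shift_invariant s T" using expansion_imp_shift_invariant by blast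
  next
    fix T0 Tk assume *: "(\<forall>k\<ge>1. Tk k \<in> sym_dual s k) \<and> lowering_expansion s P T T0 Tk"
    then show "T (const_poly s 1) = const_poly s T0" using expansion_coefficients(1) by blast
    fix k :: nat assume "k \<ge> 1"
    with * show "\<forall>f\<in>sym_power s k. Tk k f = 1 / fact k * T (\<lambda>\<omega>. poly_seq s P k \<omega> f) 0"
      using expansion_coefficients(2)[of Tk] unfolding eta by blast
  qed
qed

end
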